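(* Let $\boldsymbol\varsigma\in\{+,-\}^n$ and $\boldsymbol\lambda\in\mathbb C^n$ with $\sum_{l=1}^n\lambda_l=0$. Define $H^\pm(z;\boldsymbol\lambda)=J(z;\pm,\dots,\pm,\boldsymbol\lambda)$. Then for all $z\in\mathbb U$ and for either choice of the upper or lower signs, $$J(z;\boldsymbol\varsigma,\boldsymbol\lambda)=e\Big(\pm\frac{\sum_{l\in L_\mp(\boldsymbol\varsigma)}\lambda_l}2\Big)\,H^\pm\Big(e^{\pm\pi i\frac{n_\mp(\boldsymbol\varsigma)}n}z;\boldsymbol\lambda\Big),$$ where $L_\pm(\boldsymbol\varsigma)=\{l:\varsigma_l=\pm\}$ and $n_\pm(\boldsymbol\varsigma)=|L_\pm(\boldsymbol\varsigma)|$.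
   Context: Notation: $e(w)=e^{2\pi iw}$, $\mathbb N=\{0,1,\dots\}$. $\mathbb U$ is the universal cover of $\mathbb C\smallsetminus\{0\}$ (Riemann surface of the logarithm): its elements are $z=xe^{i\omega}$ with $x>0$, $\omega=\arg z\in\mathbb R$; $\mathbb R_+\subset\mathbb U$ consists of the elements with $\omega=0$; multiplication by $e^{i\alpha}$ increases $\arg z$ by $\alpha$. For $x>0$, $$J(x;\boldsymbol\varsigma,\boldsymbol\lambda)=\frac1{2\pi i}\int_{\mathcal C}\prod_{l=1}^n\Gamma(s-\lambda_l)\,e\Big(\frac{\varsigma_l(s-\lambda_l)}4\Big)\,x^{-ns}ds,$$ where $\mathcal C$ is any contour going upward from $\sigma-i\infty$ to $\sigma+i\infty$ with $\sigma<\frac12+\frac1n(\mathrm{Re}\sum_l\lambda_l-1)$, having all the sets $\lambda_l-\mathbb N$ on its left, and with $\mathrm{Re}\,s=\sigma$ for $s\in\mathcal C$ with $|\mathrm{Im}\,s|$ large. This function extends analytically from $\mathbb R_+$ to $\mathbb U$, and $J(z;\boldsymbol\varsigma,\boldsymbol\lambda)$, $z\in\mathbb U$, denotes the extension. *)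

theory Defs
  imports "HOL-Complex_Analysis.Complex_Analysis"
begin

datatype sign = Plus | Minus

fun sign_val :: "sign \<Rightarrow> complex" where
  "sign_val Plus = 1"
| "sign_val Minus = -1"

definition sign_idx :: "sign \<Rightarrow> sign ^ 'n \<Rightarrow> ('n::finite) set" where
  "sign_idx p vs = {l. vs $ l = p}"

definition e :: "complex \<Rightarrow> complex" where
  "e w = exp (2 * of_real pi * \<i> * w)"

text \<open>
  The universal cover of the punctured plane. The point \<open>x exp(\<i> \<omega>)\<close>, with \<open>\<omega>\<close> a real number
  that is not reduced modulo \<open>2 pi\<close>, is the pair \<open>(x, \<omega>)\<close>.
\<close>
definition log_surface :: "(real \<times> real) set" where
  "log_surface = {(x, \<omega>). 0 < x}"

definition rotate_by :: "real \<Rightarrow> real \<times> real \<Rightarrow> real \<times> real" where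
  "rotate_by \<alpha> z = (fst z, snd z + \<alpha>)"

text \<open>
  The complex structure of the surface is the one for which the projection \<open>(x, \<omega>) \<mapsto> x exp(\<i> \<omega>)\<close>
  is locally biholomorphic. The exponential map \<open>w \<mapsto> (exp (Re w), Im w)\<close> lifts the entire function
  \<open>exp\<close> through this projection and is a biholomorphism of the plane onto the surface, so
  analyticity on the surface can be tested in this one global chart.
\<close>
definition analytic_on_log_surface :: "(real \<times> real \<Rightarrow> complex) \<Rightarrow> bool" where
  "analytic_on_log_surface F \<longleftrightarrow> (\<lambda>w. F (exp (Re w), Im w)) holomorphic_on UNIV"

text \<open>
  A contour from \<open>\<sigma> - \<i>\<infinity>\<close> to \<open>\<sigma> + \<i>\<infinity>\<close> that eventually stays on the line \<open>Re s = \<sigma>\<close> is given by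
  \<open>\<sigma>\<close>, a height \<open>T\<close> and a path \<open>g\<close>: first the vertical ray up to \<open>\<sigma> - \<i> T\<close>, then \<open>g\<close>, and then
  the vertical ray starting from \<open>\<sigma> + \<i> T\<close>.
\<close>
definition upward_contour :: "real \<Rightarrow> real \<Rightarrow> (real \<Rightarrow> complex) \<Rightarrow> bool" where
  "upward_contour \<sigma> T g \<longleftrightarrow>
     0 < T \<and> valid_path g \<and> pathstart g = Complex \<sigma> (- T) \<and> pathfinish g = Complex \<sigma> T"

definition contour_image :: "real \<Rightarrow> real \<Rightarrow> (real \<Rightarrow> complex) \<Rightarrow> complex set" where
  "contour_image \<sigma> T g = Complex \<sigma> ` {..- T} \<union> path_image g \<union> Complex \<sigma> ` {T..}"

text \<open>
  The left side of the contour is the component of its complement that contains all points with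
  sufficiently negative real part.
\<close>
definition left_of_contour :: "real \<Rightarrow> real \<Rightarrow> (real \<Rightarrow> complex) \<Rightarrow> complex set" where
  "left_of_contour \<sigma> T g =
     {p. \<exists>r. \<forall>q. Re q \<le> r \<longrightarrow> connected_component (- contour_image \<sigma> T g) p q}"

text \<open>The integrals over the two rays are improper ones; note \<open>ds = \<i> dt\<close> for \<open>s = \<sigma> + \<i> t\<close>.\<close>
definition has_upward_integral ::
  "(complex \<Rightarrow> complex) \<Rightarrow> complex \<Rightarrow> real \<Rightarrow> real \<Rightarrow> (real \<Rightarrow> complex) \<Rightarrow> bool" where
  "has_upward_integral f I \<sigma> T g \<longleftrightarrow>
     (\<exists>I1 I2 I3. ((\<lambda>t. f (Complex \<sigma> t) * \<i>) has_integral I1) {..- T} \<and>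
        (f has_contour_integral I2) g \<and>
        ((\<lambda>t. f (Complex \<sigma> t) * \<i>) has_integral I3) {T..} \<and>
        I = I1 + I2 + I3)"

definition admissible :: "complex ^ 'n::finite \<Rightarrow> real \<Rightarrow> real \<Rightarrow> (real \<Rightarrow> complex) \<Rightarrow> bool" where
  "admissible lam \<sigma> T g \<longleftrightarrow>
     upward_contour \<sigma> T g \<and>
     \<sigma> < 1 / 2 + 1 / real CARD('n) * (Re (\<Sum>l\<in>UNIV. lam $ l) - 1) \<and>
     (\<forall>l. \<forall>k::nat. lam $ l - of_nat k \<in> left_of_contour \<sigma> T g)"

definition J_integrand :: "real \<Rightarrow> sign ^ 'n::finite \<Rightarrow> complex ^ 'n \<Rightarrow> complex \<Rightarrow> complex" where
  "J_integrand x vs lam s =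
     (\<Prod>l\<in>UNIV. Gamma (s - lam $ l) * e (sign_val (vs $ l) * (s - lam $ l) / 4)) *
     of_real x powr (- (of_nat CARD('n) * s))"

text \<open>The value of the integral is the same for all admissible contours.\<close>
definition J_pos :: "real \<Rightarrow> sign ^ 'n::finite \<Rightarrow> complex ^ 'n \<Rightarrow> complex" where
  "J_pos x vs lam =
     (THE v. \<exists>I. v = 1 / (2 * of_real pi * \<i>) * I \<and>
        (\<forall>\<sigma> T g. admissible lam \<sigma> T g \<longrightarrow> has_upward_integral (J_integrand x vs lam) I \<sigma> T g))"

text \<open>
  The analytic extension from the positive reals (the points \<open>(x, 0)\<close>). It is determined only on
  \<^const>\<open>log_surface\<close>; values at other pairs are meaningless.
\<close>
definition J :: "real \<times> real \<Rightarrow> sign ^ 'n::finite \<Rightarrow> complex ^ 'n \<Rightarrow> complex" where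
  "J z vs lam =
     (SOME F. analytic_on_log_surface F \<and> (\<forall>x>0. F (x, 0) = J_pos x vs lam)) z"

definition H :: "sign \<Rightarrow> real \<times> real \<Rightarrow> complex ^ 'n::finite \<Rightarrow> complex" where
  "H p z lam = J z (\<chi> l. p) lam"

end

theory Submission
  imports Defs "HOL-Real_Asymp.Real_Asymp"
begin

text \<open>
  Put \<open>P(s) = \<Prod>\<^sub>l \<Gamma>(s - \<lambda>\<^sub>l)\<close>. The exponential factors of the integrand depend on the signs only
  through \<open>\<Sum> \<sigma>\<^sub>l\<close> and \<open>\<Sum> \<sigma>\<^sub>l \<lambda>\<^sub>l\<close>, so up to a constant every \<open>J\<close> is the integral \<open>F(w)\<close> of
  \<open>P(s) exp(- n s w)\<close> at \<open>w = ln x - \<pi> \<i> (\<Sum> \<sigma>\<^sub>l) / (2 n)\<close>: changing the signs rotates the argument.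
  Here \<open>|Im w| \<le> \<pi> / 2\<close>, and \<open>|\<Gamma>(u + \<i> t)| \<le> C |t|\<^bsup>u - 1/2\<^esup> exp(- \<pi> |t| / 2)\<close> uniformly for \<open>u\<close> bounded
  above makes the integral converge in this closed strip and lets the ends of the contour be bent
  to the left. On the bent contour the integrand decays faster than any exponential, so \<open>F\<close> is
  entire; it therefore provides the continuation to the whole surface.
\<close>

section \<open>Gamma on vertical lines\<close>

text \<open>The delicate case is that of equal signs, hence \<open>H\<close> itself: there |Im w| =
  \<pi>/2, and the exponential decay of the Gamma factors can be cancelled completely along one end
  of the contour. On the line Re s = \<sigma> only |t|^q is then left, with q = n (\<sigma> - 1/2) -
  Re sum \<open>lam\<close>, and the bound on \<sigma> in \<open>admissible\<close> says exactly
  that q < -1. So the Gamma bound needs the sharp power of |t|, and it must be uniform as Re s tends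
  to minus infinity, where the ends of the contour are moved. The other obstacle is the form of the
  definitions: \<open>J_pos\<close> is a description over all admissible contours, and
  \<open>J\<close> is a choice among extensions. Hence every admissible contour must be shown to
  give the same value, at least one must exist, and extensions must be unique on the surface. The
  condition that \<open>lam\<close> has sum 0 fixes the constants: it makes the prefactor for equal
  signs 1 and expresses the mixed one by a single partial sum.\<close>

lemma norm_shift_quotient_le:
  fixes w :: complex and a :: real
  assumes "2 \<le> norm w" "0 \<le> a" "a \<le> 1"
  shows "norm w / norm (w + a) \<le> (norm w / norm (w + 1)) powr a * exp (4 / (norm w)\<^sup>2)"
proof -
  define v where "v = 1 / w"
  have w0: "w \<noteq> 0" using assms(1) by auto
  have v2: "norm v \<le> 1 / 2" using assms(1) by (simp add: v_def norm_divide divide_le_eq)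
  \<comment> \<open>After taking logarithms the claim compares a ln(1 + v) with ln(1 + a v). Both
    have linear part a v, and each of the two remainders costs at most 2 |v|^2 because |v| \<le>
    1/2; together this is the 4 / |w|^2 of the statement.\<close>
  have quad: "norm (ln (1 + b * v) - b * v) \<le> 2 * (norm v)\<^sup>2" if "0 \<le> b" "b \<le> 1" for b :: real
  proof -
    have bv: "norm (b * v) \<le> norm v"
      using that by (simp add: norm_mult mult_left_le_one_le)
    then have "norm (ln (1 + b * v) - b * v) \<le> (norm (b * v))\<^sup>2 / (1 - norm (b * v))"
      using v2 by (intro Ln_approx_linear) simp
    also have "\<dots> \<le> (norm v)\<^sup>2 / (1 / 2)"
      using bv v2 by (intro frac_le power_mono) auto
    finally show ?thesis by simp
  qed
  have ne: "1 + b * v \<noteq> 0" if "0 \<le> b" "b \<le> 1" for b :: real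
  proof
    assume "1 + b * v = 0"
    then have "norm (b * v) = 1" by (metis add_eq_0_iff norm_minus_cancel norm_one)
    then show False using that v2 mult_mono[of b 1 "norm v" "1/2"] by (simp add: norm_mult)
  qed
  have "norm (a * ln (1 + v) - ln (1 + a * v)) =
        norm (a * (ln (1 + v) - v) - (ln (1 + a * v) - a * v))"
    by (simp add: algebra_simps)
  also have "\<dots> \<le> norm (a * (ln (1 + v) - v)) + norm (ln (1 + a * v) - a * v)"
    by (rule norm_triangle_ineq4)
  also have "\<dots> \<le> 1 * (2 * (norm v)\<^sup>2) + 2 * (norm v)\<^sup>2"
  proof (rule add_mono)
    show "norm (a * (ln (1 + v) - v)) \<le> 1 * (2 * (norm v)\<^sup>2)"
      unfolding norm_mult using quad[of 1] assms by (intro mult_mono) auto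
    show "norm (ln (1 + a * v) - a * v) \<le> 2 * (norm v)\<^sup>2"
      using quad[of a] assms by simp
  qed
  finally have "Re (a * ln (1 + v) - ln (1 + a * v)) \<le> 4 * (norm v)\<^sup>2"
    using complex_Re_le_cmod order_trans by fastforce
  then have "a * ln (norm (1 + v)) - ln (norm (1 + a * v)) \<le> 4 * (norm v)\<^sup>2"
    using ne[of 1] ne[of a] assms by simp
  then have "- ln (norm (1 + a * v)) \<le> - a * ln (norm (1 + v)) + 4 * (norm v)\<^sup>2"
    by simp
  then have "exp (- ln (norm (1 + a * v))) \<le> exp (- a * ln (norm (1 + v)) + 4 * (norm v)\<^sup>2)"
    by simp
  then have *: "1 / norm (1 + a * v) \<le> norm (1 + v) powr (- a) * exp (4 * (norm v)\<^sup>2)"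
    using ne[of 1] ne[of a] assms
    by (simp add: exp_minus[of "ln _"] exp_add[symmetric] powr_def divide_inverse)
  have b: "norm (1 + b * v) = norm (w + b) / norm w" for b :: real
  proof -
    have "1 + b * v = (w + b) / w" using w0 by (simp add: v_def field_simps)
    then show ?thesis by (simp add: norm_divide)
  qed
  have "norm (1 + v) powr (- a) = (norm w / norm (w + 1)) powr a"
    using b[of 1] by (simp add: powr_minus powr_divide)
  then show ?thesis
    using * b[of a] by (simp add: v_def norm_divide power_divide)
qed

lemma prod_norm_shift_quotient_le:
  fixes z :: complex and a :: real
  assumes "\<And>k. 2 \<le> norm (z + of_nat k)" "0 \<le> a" "a \<le> 1"
  shows "(\<Prod>k<N. norm (z + of_nat k) / norm (z + a + of_nat k)) \<le>
    (norm z / norm (z + of_nat N)) powr a * exp (\<Sum>k<N. 4 / (norm (z + of_nat k))\<^sup>2)"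
proof (induction N)
  case 0
  then show ?case using assms(1)[of 0] by auto
next
  case (Suc N)
  let ?p = "\<lambda>k. norm (z + of_nat k)"
  have pos: "?p k > 0" for k using assms(1)[of k] by linarith
  have "(\<Prod>k<Suc N. ?p k / norm (z + a + of_nat k)) =
      (\<Prod>k<N. ?p k / norm (z + a + of_nat k)) * (?p N / norm (z + of_nat N + a))"
    by (simp add: add_ac)
  also have "\<dots> \<le> ((norm z / ?p N) powr a * exp (\<Sum>k<N. 4 / (?p k)\<^sup>2)) *
      ((?p N / norm (z + of_nat N + 1)) powr a * exp (4 / (?p N)\<^sup>2))"
    using Suc assms by (intro mult_mono norm_shift_quotient_le prod_nonneg) auto
  also have "\<dots> = ((norm z / ?p N) * (?p N / ?p (Suc N))) powr a *
      exp (\<Sum>k<Suc N. 4 / (?p k)\<^sup>2)"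
    by (subst powr_mult) (simp add: exp_add add_ac)
  also have "(norm z / ?p N) * (?p N / ?p (Suc N)) = norm z / ?p (Suc N)"
    using pos[of N] by auto
  finally show ?case .
qed

lemma cosh_of_real_complex: "cosh (complex_of_real x) = of_real (cosh x)"
  by (simp add: cosh_field_def exp_of_real flip: of_real_minus)

text \<open>On Re s = 1/2 conjugation is s -> 1 - s, so the reflection formula evaluates the modulus
  exactly: |Gamma|^2 = \<pi> / cosh(\<pi> t). All bounds on other vertical lines are transported
  from this one.\<close>

lemma norm_Gamma_half:
  "norm (Gamma (Complex (1/2) t)) \<le> sqrt (2 * pi) * exp (- (pi * \<bar>t\<bar> / 2))"
proof -
  have "cnj (Complex (1/2) t) = 1 - Complex (1/2) t"
    by (simp add: complex_eq_iff)
  then have "Gamma (Complex (1/2) t) * cnj (Gamma (Complex (1/2) t)) =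
      of_real pi / sin (of_real pi * Complex (1/2) t)"
    using Gamma_reflection_complex[of "Complex (1/2) t"] by (simp add: cnj_Gamma)
  also have "of_real pi * Complex (1/2) t = of_real pi / 2 - (- (\<i> * of_real (pi * t)))"
    by (simp add: complex_eq_iff)
  also have "sin \<dots> = cosh (of_real (pi * t))"
    by (simp only: cos_sin_eq[symmetric] cosh_conv_cos cos_minus)
  also have "\<dots> = of_real (cosh (pi * t))"
    by (rule cosh_of_real_complex)
  finally have "complex_of_real ((norm (Gamma (Complex (1/2) t)))\<^sup>2) = of_real (pi / cosh (pi * t))"
    by (simp add: complex_norm_square[symmetric])
  then have sq: "(norm (Gamma (Complex (1/2) t)))\<^sup>2 = pi / cosh (pi * t)"
    using of_real_eq_iff by blast
  have "exp (pi * \<bar>t\<bar>) \<le> 2 * cosh (pi * t)"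
    by (auto simp: cosh_def abs_if)
  then have "pi / cosh (pi * t) \<le> 2 * pi * exp (- (pi * \<bar>t\<bar>))"
    by (simp add: exp_minus field_simps)
  also have "\<dots> = (sqrt (2 * pi) * exp (- (pi * \<bar>t\<bar> / 2)))\<^sup>2"
    unfolding power_mult_distrib exp_double[symmetric] by simp
  finally show ?thesis
    unfolding sq[symmetric] by (rule power2_le_imp_le) simp
qed

text \<open>
  Apart from a summable error, \<open>|w| / |w + a|\<close> is at most \<open>(|w| / |w + 1|)\<^bsup>a\<^esup>\<close>, whose product along
  \<open>w = z, z + 1, \<dots>\<close> telescopes. Hence the product formula compares \<open>\<Gamma>(z + a)\<close> with \<open>\<Gamma>(z)\<close>.
\<close>

lemma norm_Gamma_strip:
  "\<exists>C>0. \<forall>a t. 0 \<le> a \<longrightarrow> a \<le> 1 \<longrightarrow> 2 \<le> \<bar>t\<bar> \<longrightarrow>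
     norm (Gamma (Complex (1/2 + a) t)) \<le> C * \<bar>t\<bar> powr a * exp (- (pi * \<bar>t\<bar> / 2))"
proof -
  \<comment> \<open>On Re z = 1/2 one has |z + k| \<ge> (k + 1)/2, so this sum dominates the
    accumulated errors 4 / |z + k|^2 independently of t.\<close>
  define S where "S = (\<Sum>k. 16 / (real k + 1)\<^sup>2)"
  have summ: "summable (\<lambda>k. 16 / (real k + 1)\<^sup>2)"
  proof -
    have "summable (\<lambda>k. 16 * inverse ((real (Suc k))\<^sup>2))"
      using inverse_power_summable[of 2, where 'a = real]
      by (intro summable_mult) (subst summable_Suc_iff, simp)
    then show ?thesis by (simp add: divide_inverse add_ac)
  qed
  \<comment> \<open>The factor 2 bounds 2^a, which arises from |z| \<le> 2 |t|; the square root
    comes from the line Re z = 1/2.\<close>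
  define C where "C = 2 * exp S * sqrt (2 * pi)"
  have "norm (Gamma (Complex (1/2 + a) t)) \<le> C * \<bar>t\<bar> powr a * exp (- (pi * \<bar>t\<bar> / 2))"
    if a: "0 \<le> a" "a \<le> 1" and t: "2 \<le> \<bar>t\<bar>" for a t
  proof -
    define z where "z = Complex (1/2) t"
    have lower: "2 \<le> norm (z + of_nat k)" for k
      using abs_Im_le_cmod[of "z + of_nat k"] t by (simp add: z_def)
    have lower': "(real k + 1) / 2 \<le> norm (z + of_nat k)" for k
      using abs_Re_le_cmod[of "z + of_nat k"] by (simp add: z_def)
    have sum_le: "(\<Sum>k<N. 4 / (norm (z + of_nat k))\<^sup>2) \<le> S" for N
    proof -
      have "4 / (norm (z + of_nat k))\<^sup>2 \<le> 16 / (real k + 1)\<^sup>2" for k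
      proof -
        have "4 / (norm (z + of_nat k))\<^sup>2 \<le> 4 / ((real k + 1) / 2)\<^sup>2"
          using lower'[of k] by (intro frac_le power_mono) auto
        then show ?thesis by (simp add: power_divide)
      qed
      then have "(\<Sum>k<N. 4 / (norm (z + of_nat k))\<^sup>2) \<le> (\<Sum>k<N. 16 / (real k + 1)\<^sup>2)"
        by (rule sum_mono)
      also have "\<dots> \<le> S"
        unfolding S_def by (intro sum_le_suminf summ) auto
      finally show ?thesis .
    qed
    have ser: "norm (Gamma_series (z + a) n) \<le>
        norm (Gamma_series z n) * (norm z powr a * exp S)" if "n > 0" for n
    proof -
      let ?N = "Suc n"
      have *: "norm (Gamma_series y n) =
          fact n * real n powr (Re y) / (\<Prod>k<?N. norm (y + of_nat k))" for y :: complex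
        using that by (simp add: Gamma_series_def norm_divide norm_mult norm_exp_eq_Re
            pochhammer_prod prod_norm powr_def mult.commute atLeast0LessThan del: prod.lessThan_Suc)
      have p0: "(\<Prod>k<?N. norm (z + of_nat k)) > 0"
        using lower by (intro prod_pos) (smt (verit))
      have nz: "z + of_nat k \<noteq> 0" for k
        using lower[of k] by auto
      have "norm (Gamma_series (z + a) n) = norm (Gamma_series z n) *
          (real n powr a * (\<Prod>k<?N. norm (z + of_nat k) / norm (z + a + of_nat k)))"
        using p0 that by (simp add: * prod_dividef powr_add nz del: prod.lessThan_Suc)
      \<comment> \<open>The factor n^a is what the series for Gamma gains when its argument moves by
        a. It is absorbed by the denominator |z + n + 1|^a that the telescoping product leaves,
        since |z + n + 1| \<ge> n.\<close>
      also have "real n powr a * (\<Prod>k<?N. norm (z + of_nat k) / norm (z + a + of_nat k))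
          \<le> real n powr a * ((norm z / norm (z + of_nat ?N)) powr a * exp S)"
        using sum_le[of ?N]
        by (intro mult_left_mono order_trans[OF prod_norm_shift_quotient_le[OF lower a, of ?N]]) auto
      also have "\<dots> = (real n / norm (z + of_nat ?N)) powr a * (norm z powr a * exp S)"
        by (simp add: powr_divide)
      also have "\<dots> \<le> 1 * (norm z powr a * exp S)"
      proof (intro mult_right_mono)
        have "real n \<le> norm (z + of_nat ?N)"
          using abs_Re_le_cmod[of "z + of_nat ?N"] by (simp add: z_def)
        then have "real n / norm (z + of_nat ?N) \<le> 1"
          by (simp add: divide_le_eq_1)
        then show "(real n / norm (z + of_nat ?N)) powr a \<le> 1"
          using a by (intro powr_le1) auto
      qed auto
      finally show ?thesis by (simp add: mult_left_mono)
    qed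
    have "(\<lambda>n. norm (Gamma_series (z + a) n)) \<longlonglongrightarrow> norm (Gamma (z + a))"
      "(\<lambda>n. norm (Gamma_series z n) * (norm z powr a * exp S)) \<longlonglongrightarrow> norm (Gamma z) * (norm z powr a * exp S)"
      by (intro tendsto_norm Gamma_series_LIMSEQ tendsto_mult tendsto_const)+
    then have "norm (Gamma (z + a)) \<le> norm (Gamma z) * (norm z powr a * exp S)"
      by (rule LIMSEQ_le) (rule exI[of _ 1], use ser in simp)
    also have "norm z \<le> 2 * \<bar>t\<bar>"
      using cmod_le[of z] t by (simp add: z_def)
    then have "norm z powr a \<le> 2 * \<bar>t\<bar> powr a"
      using a powr_mono2[of a "norm z" "2 * \<bar>t\<bar>"] powr_mono[of a 1 2]
      by (simp add: powr_mult) (metis mult_right_mono order_trans powr_ge_zero)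
    then have "norm (Gamma z) * (norm z powr a * exp S) \<le>
        (sqrt (2 * pi) * exp (- (pi * \<bar>t\<bar> / 2))) * ((2 * \<bar>t\<bar> powr a) * exp S)"
      using norm_Gamma_half[of t] by (intro mult_mono) (auto simp: z_def)
    also have "\<dots> = C * \<bar>t\<bar> powr a * exp (- (pi * \<bar>t\<bar> / 2))"
      by (simp add: C_def)
    also have "z + a = Complex (1/2 + a) t"
      by (simp add: z_def complex_eq_iff)
    finally show ?thesis .
  qed
  moreover have "C > 0" by (simp add: C_def)
  ultimately show ?thesis by blast
qed

lemma Complex_not_nonpos_Ints: "t \<noteq> 0 \<Longrightarrow> Complex u t \<notin> \<int>\<^sub>\<le>\<^sub>0"
  by (auto elim!: nonpos_Ints_cases simp: complex_eq_iff)

text \<open>The recursion Gamma(s + 1) = s Gamma(s) and |s| \<ge> |t| carry the bound from u + 1 to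
  u with the same constant, because the claimed power also drops by one factor |t|. Hence one strip
  of width 1 controls everything to its left uniformly. Steps to the right use |s| \<le> (k + 3) |t|
  and enlarge the constant, so only finitely many are taken, up to A.\<close>

lemma norm_Gamma_left:
  "\<exists>C>0. \<forall>u t. u \<le> A \<longrightarrow> 2 \<le> \<bar>t\<bar> \<longrightarrow>
     norm (Gamma (Complex u t)) \<le> C * \<bar>t\<bar> powr (u - 1/2) * exp (- (pi * \<bar>t\<bar> / 2))"
proof -
  define bounded where "bounded C u \<longleftrightarrow> (\<forall>t. 2 \<le> \<bar>t\<bar> \<longrightarrow>
     norm (Gamma (Complex u t)) \<le> C * \<bar>t\<bar> powr (u - 1/2) * exp (- (pi * \<bar>t\<bar> / 2)))" for C u
  have shift: "Gamma (Complex (u + 1) t) = Complex u t * Gamma (Complex u t)" if "t \<noteq> 0" for u t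
    using Gamma_plus1[OF Complex_not_nonpos_Ints[OF that, of u]]
    by (simp add: plus_complex.code one_complex.code)
  have down: "bounded C u" if "bounded C (u + 1)" for C u
    unfolding bounded_def
  proof (intro allI impI)
    fix t :: real assume t: "2 \<le> \<bar>t\<bar>"
    have "\<bar>t\<bar> * norm (Gamma (Complex u t)) \<le> norm (Gamma (Complex (u + 1) t))"
      using abs_Im_le_cmod[of "Complex u t"] t by (simp add: shift norm_mult mult_right_mono)
    also have "\<dots> \<le> C * \<bar>t\<bar> powr (1 + (u - 1/2)) * exp (- (pi * \<bar>t\<bar> / 2))"
      using that t by (simp add: bounded_def algebra_simps)
    also have "\<dots> = \<bar>t\<bar> * (C * \<bar>t\<bar> powr (u - 1/2) * exp (- (pi * \<bar>t\<bar> / 2)))"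
      using t unfolding powr_add by simp
    finally show "norm (Gamma (Complex u t)) \<le> C * \<bar>t\<bar> powr (u - 1/2) * exp (- (pi * \<bar>t\<bar> / 2))"
      using t by (simp add: mult_le_cancel_left)
  qed
  have base: "\<exists>C>0. \<forall>u\<le>3/2. bounded C u"
  proof -
    obtain C where C: "C > 0" and strip: "\<And>a t. 0 \<le> a \<Longrightarrow> a \<le> 1 \<Longrightarrow> 2 \<le> \<bar>t\<bar> \<Longrightarrow>
        norm (Gamma (Complex (1/2 + a) t)) \<le> C * \<bar>t\<bar> powr a * exp (- (pi * \<bar>t\<bar> / 2))"
      using norm_Gamma_strip by blast
    have "bounded C u" if "1/2 - real k \<le> u" "u \<le> 3/2" for k u
      using that
    proof (induction k arbitrary: u)
      case 0
      then show ?case using strip[of "u - 1/2"] by (simp add: bounded_def)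
    next
      case (Suc k)
      show ?case
      proof (cases "1/2 \<le> u")
        case True
        then show ?thesis using Suc.IH[of u] Suc.prems by simp
      next
        case False
        then show ?thesis using Suc.IH[of "u + 1"] Suc.prems by (simp add: down)
      qed
    qed
    moreover have "\<exists>k::nat. 1/2 - real k \<le> u" for u :: real
      by (metis real_arch_simple diff_le_eq add.commute)
    ultimately have "\<forall>u\<le>3/2. bounded C u" by metis
    then show ?thesis using C by auto
  qed
  have "\<exists>C>0. \<forall>u\<le>3/2 + real k. bounded C u" for k
  proof (induction k)
    case 0
    then show ?case using base by simp
  next
    case (Suc k)
    then obtain C where C: "C > 0" "\<And>u. u \<le> 3/2 + real k \<Longrightarrow> bounded C u" by blast
    have "bounded (C * (real k + 3)) u" if u: "u \<le> 3/2 + real (Suc k)" for u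
      unfolding bounded_def
    proof (intro allI impI)
      fix t :: real assume t: "2 \<le> \<bar>t\<bar>"
      show "norm (Gamma (Complex u t)) \<le>
          C * (real k + 3) * \<bar>t\<bar> powr (u - 1/2) * exp (- (pi * \<bar>t\<bar> / 2))"
      proof (cases "u \<le> 3/2 + real k")
        case True
        then have "norm (Gamma (Complex u t)) \<le> C * 1 * \<bar>t\<bar> powr (u - 1/2) * exp (- (pi * \<bar>t\<bar> / 2))"
          using C(2)[of u] t by (simp add: bounded_def)
        also have "\<dots> \<le> C * (real k + 3) * \<bar>t\<bar> powr (u - 1/2) * exp (- (pi * \<bar>t\<bar> / 2))"
          using C(1) by (intro mult_right_mono mult_left_mono) auto
        finally show ?thesis .
      next
        case False
        have "norm (Complex (u - 1) t) \<le> \<bar>u - 1\<bar> + \<bar>t\<bar>"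
          using cmod_le[of "Complex (u - 1) t"] by simp
        also have "\<dots> \<le> (real k + 2) * 1 + \<bar>t\<bar>"
          using False u by simp
        also have "\<dots> \<le> (real k + 2) * \<bar>t\<bar> + \<bar>t\<bar>"
          using t by (intro add_right_mono mult_left_mono) auto
        finally have z: "norm (Complex (u - 1) t) \<le> (real k + 3) * \<bar>t\<bar>"
          by (simp add: algebra_simps)
        have "norm (Gamma (Complex u t)) = norm (Complex (u - 1) t) * norm (Gamma (Complex (u - 1) t))"
          using shift[of t "u - 1"] t by (auto simp: norm_mult)
        also have "\<dots> \<le> ((real k + 3) * \<bar>t\<bar>) * (C * \<bar>t\<bar> powr (u - 1 - 1/2) * exp (- (pi * \<bar>t\<bar> / 2)))"
          using C(2)[of "u - 1"] u t z by (intro mult_mono) (auto simp: bounded_def)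
        also have "\<dots> = C * (real k + 3) * (\<bar>t\<bar> powr (1 + (u - 1 - 1/2))) * exp (- (pi * \<bar>t\<bar> / 2))"
          using t unfolding powr_add by simp
        finally show ?thesis by simp
      qed
    qed
    then show ?case using C(1) by (intro exI[of _ "C * (real k + 3)"]) auto
  qed
  moreover obtain k where "A - 3/2 \<le> real k"
    using real_arch_simple by blast
  ultimately obtain C where "C > 0" "\<And>u. u \<le> 3/2 + real k \<Longrightarrow> bounded C u" by blast
  then show ?thesis
    using \<open>A - 3/2 \<le> real k\<close> unfolding bounded_def by (intro exI[of _ C]) auto
qed

text \<open>
  The separate factor \<open>(|t| / 2)\<^bsup>u - A\<^esup>\<close> keeps the constant independent of \<open>u\<close> down to \<open>- \<infinity>\<close>.
\<close>

lemma norm_Gamma_shifted: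
  fixes c :: complex and A :: real
  shows "\<exists>C>0. \<forall>u t. u \<le> A \<longrightarrow> 4 + 2 * \<bar>Im c\<bar> \<le> \<bar>t\<bar> \<longrightarrow>
    norm (Gamma (Complex u t - c)) \<le>
      C * \<bar>t\<bar> powr (A - Re c - 1/2) * (\<bar>t\<bar> / 2) powr (u - A) * exp (- (pi * \<bar>t\<bar> / 2))"
proof -
  define q where "q = A - Re c - 1/2"
  obtain C0 where C0: "C0 > 0" and bd: "\<And>u t. u \<le> A - Re c \<Longrightarrow> 2 \<le> \<bar>t\<bar> \<Longrightarrow>
     norm (Gamma (Complex u t)) \<le> C0 * \<bar>t\<bar> powr (u - 1/2) * exp (- (pi * \<bar>t\<bar> / 2))"
    using norm_Gamma_left by blast
  define C where "C = C0 * 2 powr \<bar>q\<bar> * exp (pi * \<bar>Im c\<bar> / 2)"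
  have "norm (Gamma (Complex u t - c)) \<le>
      C * \<bar>t\<bar> powr q * (\<bar>t\<bar> / 2) powr (u - A) * exp (- (pi * \<bar>t\<bar> / 2))"
    if u: "u \<le> A" and t: "4 + 2 * \<bar>Im c\<bar> \<le> \<bar>t\<bar>" for u t
  proof -
    define s where "s = \<bar>t - Im c\<bar>"
    \<comment> \<open>The threshold for |t| keeps |t - Im c| between |t|/2 and 2 |t|. The upper
      bound serves the fixed power q if it is nonnegative, the lower one if it is negative. The
      exponent u - A is never positive, so the lower bound alone suffices there and costs no
      constant depending on u.\<close>
    have s: "\<bar>t\<bar> / 2 \<le> s" "s \<le> 2 * \<bar>t\<bar>" "2 \<le> s" "\<bar>t\<bar> - \<bar>Im c\<bar> \<le> s"
      using t abs_triangle_ineq2[of t "Im c"] by (auto simp: s_def)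
    have "Complex u t - c = Complex (u - Re c) (t - Im c)"
      by (simp add: complex_eq_iff)
    then have "norm (Gamma (Complex u t - c)) \<le> C0 * s powr (u - Re c - 1/2) * exp (- (pi * s / 2))"
      using bd[of "u - Re c" "t - Im c"] u s(3) by (simp add: s_def)
    also have "s powr (u - Re c - 1/2) = s powr q * s powr (u - A)"
      by (simp add: q_def algebra_simps flip: powr_add)
    also have "C0 * (s powr q * s powr (u - A)) * exp (- (pi * s / 2)) \<le>
        C0 * ((2 powr \<bar>q\<bar> * \<bar>t\<bar> powr q) * (\<bar>t\<bar> / 2) powr (u - A)) *
        (exp (pi * \<bar>Im c\<bar> / 2) * exp (- (pi * \<bar>t\<bar> / 2)))"
    proof (intro mult_mono)
      show "s powr q \<le> 2 powr \<bar>q\<bar> * \<bar>t\<bar> powr q"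
      proof (cases "0 \<le> q")
        case True
        then show ?thesis using powr_mono2[of q s "2 * \<bar>t\<bar>"] s by (simp add: powr_mult)
      next
        case False
        then have "s powr q \<le> (\<bar>t\<bar> / 2) powr q"
          using s t by (intro powr_mono2') auto
        also have "\<dots> = 2 powr (- q) * \<bar>t\<bar> powr q"
          unfolding powr_divide powr_minus by (simp add: field_simps)
        finally show ?thesis using False by simp
      qed
      show "s powr (u - A) \<le> (\<bar>t\<bar> / 2) powr (u - A)"
        using s t u by (intro powr_mono2') auto
      have "pi * (\<bar>t\<bar> - \<bar>Im c\<bar>) \<le> pi * s"
        using s by (intro mult_left_mono) auto
      then show "exp (- (pi * s / 2)) \<le> exp (pi * \<bar>Im c\<bar> / 2) * exp (- (pi * \<bar>t\<bar> / 2))"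
        by (simp add: algebra_simps flip: exp_add)
    qed (use C0 in auto)
    also have "\<dots> = C * \<bar>t\<bar> powr q * (\<bar>t\<bar> / 2) powr (u - A) * exp (- (pi * \<bar>t\<bar> / 2))"
      by (simp add: C_def)
    finally show ?thesis .
  qed
  moreover have "C > 0" using C0 by (simp add: C_def)
  ultimately show ?thesis unfolding q_def by blast
qed

definition Gamma_prod :: "complex ^ 'n::finite \<Rightarrow> complex \<Rightarrow> complex" where
  "Gamma_prod lam s = (\<Prod>l\<in>UNIV. Gamma (s - lam $ l))"

text \<open>The fixed powers of |t| add up to n (A - 1/2) - Re sum \<open>lam\<close>. For A =
  \<sigma> this is the exponent that the condition on \<sigma> in \<open>admissible\<close> forces
  below -1.\<close>

lemma norm_Gamma_prod_le:
  fixes lam :: "complex ^ 'n::finite" and A :: real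
  defines "n \<equiv> real CARD('n)"
  shows "\<exists>C>0. \<exists>T\<ge>4. \<forall>u t. u \<le> A \<longrightarrow> T \<le> \<bar>t\<bar> \<longrightarrow> norm (Gamma_prod lam (Complex u t)) \<le>
    C * \<bar>t\<bar> powr (n * (A - 1/2) - Re (\<Sum>l\<in>UNIV. lam $ l)) * (\<bar>t\<bar> / 2) powr (n * (u - A)) *
    exp (- (n * pi * \<bar>t\<bar> / 2))"
proof -
  have "\<forall>l. \<exists>C>0. \<forall>u t. u \<le> A \<longrightarrow> 4 + 2 * \<bar>Im (lam $ l)\<bar> \<le> \<bar>t\<bar> \<longrightarrow>
    norm (Gamma (Complex u t - lam $ l)) \<le>
      C * \<bar>t\<bar> powr (A - Re (lam $ l) - 1/2) * (\<bar>t\<bar> / 2) powr (u - A) * exp (- (pi * \<bar>t\<bar> / 2))"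
    using norm_Gamma_shifted by blast
  then obtain C where C: "\<And>l. C l > 0" "\<And>l u t. u \<le> A \<Longrightarrow> 4 + 2 * \<bar>Im (lam $ l)\<bar> \<le> \<bar>t\<bar> \<Longrightarrow>
    norm (Gamma (Complex u t - lam $ l)) \<le>
      C l * \<bar>t\<bar> powr (A - Re (lam $ l) - 1/2) * (\<bar>t\<bar> / 2) powr (u - A) * exp (- (pi * \<bar>t\<bar> / 2))"
    by metis
  define T where "T = 4 + (\<Sum>l\<in>UNIV. 2 * \<bar>Im (lam $ l)\<bar>)"
  have T: "4 + 2 * \<bar>Im (lam $ l)\<bar> \<le> T" for l
    unfolding T_def by (intro add_left_mono member_le_sum) auto
  have "norm (Gamma_prod lam (Complex u t)) \<le>
    (\<Prod>l\<in>UNIV. C l) * \<bar>t\<bar> powr (n * (A - 1/2) - Re (\<Sum>l\<in>UNIV. lam $ l)) *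
    (\<bar>t\<bar> / 2) powr (n * (u - A)) * exp (- (n * pi * \<bar>t\<bar> / 2))"
    if "u \<le> A" "T \<le> \<bar>t\<bar>" for u t
  proof -
    have t: "t \<noteq> 0" using T[of undefined] that by auto
    have "norm (Gamma_prod lam (Complex u t)) = (\<Prod>l\<in>UNIV. norm (Gamma (Complex u t - lam $ l)))"
      by (simp add: Gamma_prod_def prod_norm)
    also have "\<dots> \<le> (\<Prod>l\<in>UNIV. C l * \<bar>t\<bar> powr (A - Re (lam $ l) - 1/2) * (\<bar>t\<bar> / 2) powr (u - A) *
        exp (- (pi * \<bar>t\<bar> / 2)))"
      using that T by (intro prod_mono) (auto intro!: C(2) intro: order_trans)
    also have "\<dots> = (\<Prod>l\<in>UNIV. C l) * \<bar>t\<bar> powr (\<Sum>l\<in>UNIV. A - Re (lam $ l) - 1/2) *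
        (\<bar>t\<bar> / 2) powr (n * (u - A)) * exp (- (pi * \<bar>t\<bar> / 2)) ^ CARD('n)"
      using t by (simp add: prod.distrib powr_sum powr_power n_def mult.commute)
    also have "exp (- (pi * \<bar>t\<bar> / 2)) ^ CARD('n) = exp (n * (- (pi * \<bar>t\<bar> / 2)))"
      unfolding n_def by (rule exp_of_nat_mult[symmetric])
    also have "(\<Sum>l\<in>UNIV. A - Re (lam $ l) - 1/2) = n * (A - 1/2) - Re (\<Sum>l\<in>UNIV. lam $ l)"
      by (simp add: sum_subtractf sum.distrib n_def algebra_simps)
    finally show ?thesis by (simp add: mult.assoc)
  qed
  moreover have "(\<Prod>l\<in>UNIV. C l) > 0" using C(1) by (intro prod_pos) auto
  moreover have "T \<ge> 4" unfolding T_def by (simp add: sum_nonneg)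
  ultimately show ?thesis by blast
qed

section \<open>The integrand and its entire transform\<close>

definition poles :: "complex ^ 'n::finite \<Rightarrow> complex set" where
  "poles lam = {lam $ l - of_nat k | l k. True}"

definition kern :: "complex ^ 'n::finite \<Rightarrow> complex \<Rightarrow> complex \<Rightarrow> complex" where
  "kern lam w s = Gamma_prod lam s * exp (- (of_nat CARD('n) * s * w))"

text \<open>A common bound for all |\<open>lam $ l\<close>|. It confines the poles to the half strip
  Re s \<le> \<open>pole_box lam\<close>, |Im s| \<le> \<open>pole_box lam\<close>, which is open
  only to the left.\<close>

definition pole_box :: "complex ^ 'n::finite \<Rightarrow> real" where
  "pole_box lam = (\<Sum>l\<in>UNIV. norm (lam $ l))"

lemma norm_le_pole_box: "norm (lam $ l) \<le> pole_box lam"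
  unfolding pole_box_def by (intro member_le_sum) auto

lemma pole_box_nonneg [simp]: "pole_box lam \<ge> 0"
  unfolding pole_box_def by (simp add: sum_nonneg)

lemma Re_pole_le: "p \<in> poles lam \<Longrightarrow> Re p \<le> pole_box lam"
proof -
  assume "p \<in> poles lam"
  then obtain l k where "p = lam $ l - of_nat k" by (auto simp: poles_def)
  then show ?thesis
    using complex_Re_le_cmod[of "lam $ l"] norm_le_pole_box[of lam l] by simp
qed

lemma abs_Im_pole_le: "p \<in> poles lam \<Longrightarrow> \<bar>Im p\<bar> \<le> pole_box lam"
proof -
  assume "p \<in> poles lam"
  then obtain l k where "p = lam $ l - of_nat k" by (auto simp: poles_def)
  then show ?thesis
    using abs_Im_le_cmod[of "lam $ l"] norm_le_pole_box[of lam l] by simp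
qed

lemma kern_holomorphic:
  assumes "S \<inter> poles lam = {}"
  shows "kern lam w holomorphic_on S"
proof -
  have "s - lam $ l \<notin> \<int>\<^sub>\<le>\<^sub>0" if "s \<in> S" for s l
  proof
    assume "s - lam $ l \<in> \<int>\<^sub>\<le>\<^sub>0"
    then obtain k where "s - lam $ l = - of_nat k" by (elim nonpos_Ints_cases') auto
    then have "s = lam $ l - of_nat k" by (simp add: algebra_simps)
    then show False using assms that by (auto simp: poles_def)
  qed
  then show ?thesis
    unfolding kern_def Gamma_prod_def by (intro holomorphic_intros) auto
qed

text \<open>
  The path of \<open>box_integral\<close> is the bent contour, cut off where its two ends meet the diagonals
  \<open>Im s = \<plusminus> Re s\<close> at \<open>Re s = - m\<close>; consecutive ones differ by integrals along these diagonals.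
\<close>

definition box_integral :: "(complex \<Rightarrow> complex) \<Rightarrow> real \<Rightarrow> real \<Rightarrow> complex" where
  "box_integral f A m =
     contour_integral (linepath (Complex (- m) (- m)) (Complex A (- m))) f +
     contour_integral (linepath (Complex A (- m)) (Complex A m)) f +
     contour_integral (linepath (Complex A m) (Complex (- m) m)) f"

text \<open>With a primitive, integrals along segments become differences of end values, so that
  rearranging polygonal paths by Cauchy's theorem reduces to algebra.\<close>

lemma holomorphic_linepath_primitive:
  assumes "f holomorphic_on S" "convex S" "open S"
  obtains Q where "\<And>a b. a \<in> S \<Longrightarrow> b \<in> S \<Longrightarrow> (f has_contour_integral (Q b - Q a)) (linepath a b)"
proof -
  obtain Q where "\<And>s. s \<in> S \<Longrightarrow> (Q has_field_derivative f s) (at s within S)"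
    using holomorphic_convex_primitive'[OF assms(2,3,1)] by auto
  then have "(f has_contour_integral (Q b - Q a)) (linepath a b)" if "a \<in> S" "b \<in> S" for a b
    using contour_integral_primitive[of S Q f "linepath a b"] that \<open>convex S\<close>
    by (simp add: closed_segment_subset)
  then show ?thesis using that by blast
qed

lemma convex_open_half_planes:
  "convex {s. c < Re s}" "convex {s. c < Im s}" "convex {s. Im s < c}"
  "open {s. c < Re s}" "open {s. c < Im s}" "open {s. Im s < c}"
  by (simp_all add: convex_halfspace_Re_gt convex_halfspace_Im_gt convex_halfspace_Im_lt
      open_halfspace_Re_gt open_halfspace_Im_gt open_halfspace_Im_lt)

text \<open>The complement of a half strip is not convex, so a primitive is taken on each of three
  half planes. The right one overlaps the upper and the lower one, and there two primitives have
  equal increments between the corners with real part A. Everything cancels except the two diagonal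
  segments.\<close>

lemma box_integral_diff:
  assumes f: "f holomorphic_on {s. b < Im s}" "f holomorphic_on {s. Im s < - b}"
      "f holomorphic_on {s. b < Re s}"
    and "b < A" "b < m" "b < m'"
  shows "box_integral f A m' - box_integral f A m =
    contour_integral (linepath (Complex (- m') (- m')) (Complex (- m) (- m))) f +
    contour_integral (linepath (Complex (- m) m) (Complex (- m') m')) f"
proof -
  obtain U where "\<And>a c. a \<in> {s. b < Im s} \<Longrightarrow> c \<in> {s. b < Im s} \<Longrightarrow>
      (f has_contour_integral (U c - U a)) (linepath a c)"
    using holomorphic_linepath_primitive[OF f(1)] convex_open_half_planes by blast
  then have U: "contour_integral (linepath a c) f = U c - U a" if "b < Im a" "b < Im c" for a c
    using that contour_integral_unique by blast
  obtain L where "\<And>a c. a \<in> {s. Im s < - b} \<Longrightarrow> c \<in> {s. Im s < - b} \<Longrightarrow>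
      (f has_contour_integral (L c - L a)) (linepath a c)"
    using holomorphic_linepath_primitive[OF f(2)] convex_open_half_planes by blast
  then have L: "contour_integral (linepath a c) f = L c - L a" if "Im a < - b" "Im c < - b" for a c
    using that contour_integral_unique by blast
  obtain R where "\<And>a c. a \<in> {s. b < Re s} \<Longrightarrow> c \<in> {s. b < Re s} \<Longrightarrow>
      (f has_contour_integral (R c - R a)) (linepath a c)"
    using holomorphic_linepath_primitive[OF f(3)] convex_open_half_planes by blast
  then have R: "contour_integral (linepath a c) f = R c - R a" if "b < Re a" "b < Re c" for a c
    using that contour_integral_unique by blast
  have "R (Complex A m') - R (Complex A m) = U (Complex A m') - U (Complex A m)"
    using U[of "Complex A m" "Complex A m'"] R[of "Complex A m" "Complex A m'"] assms by simp
  moreover have "R (Complex A (- m')) - R (Complex A (- m)) = L (Complex A (- m')) - L (Complex A (- m))"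
    using L[of "Complex A (- m)" "Complex A (- m')"] R[of "Complex A (- m)" "Complex A (- m')"] assms
    by simp
  ultimately show ?thesis
    using assms unfolding box_integral_def by (simp add: U L R algebra_simps)
qed

lemma holomorphic_on_linepath_integral:
  assumes "continuous_on (closed_segment a b) P"
  shows "(\<lambda>w. contour_integral (linepath a b) (\<lambda>s. P s * exp (- (c * s * w)))) holomorphic_on UNIV"
proof -
  define f where "f w t = P (linepath a b t) * exp (- (c * linepath a b t * w)) * (b - a)" for w t
  have P: "continuous_on {0..1} (\<lambda>t. P (linepath a b t))"
    by (rule continuous_on_compose2[OF assms]) (auto simp: linepath_in_path intro: continuous_on_linepath)
  have P': "continuous_on (UNIV \<times> {0..1}) (\<lambda>(w::complex, t). P (linepath a b t))"
    unfolding split_beta by (rule continuous_on_compose2[OF P]) (auto intro!: continuous_intros)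
  have int: "f w integrable_on {0..1}" for w
    unfolding f_def by (intro integrable_continuous_interval continuous_intros P)
  have "(\<lambda>w. integral (cbox 0 1) (f w)) holomorphic_on UNIV"
  proof (rule leibniz_rule_holomorphic)
    show "((\<lambda>w. f w t) has_field_derivative
        - (c * linepath a b t) * f w t) (at w within UNIV)" for w t
      unfolding f_def by (auto intro!: derivative_eq_intros)
    show "f w integrable_on cbox 0 1" for w using int by simp
    show "continuous_on (UNIV \<times> cbox 0 1) (\<lambda>(w, t). - (c * linepath a b t) * f w t)"
      using P' unfolding f_def split_beta by (auto simp: linepath_def intro!: continuous_intros)
  qed auto
  moreover have "contour_integral (linepath a b) (\<lambda>s. P s * exp (- (c * s * w))) = integral {0..1} (f w)" for w
    using int[of w] unfolding f_def
    by (intro contour_integral_unique) (simp add: has_contour_integral_linepath integrable_integral del: integral_mult_left)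
  ultimately show ?thesis by simp
qed

text \<open>At Re s = -\<tau>, |Im s| = \<tau> the Gamma factors contribute (\<tau>/2)^(- n \<tau>),
  which beats the factor exp(2 n \<tau> R) allowed to the exponential when |w| \<le> R. This gives
  locally uniform convergence in w without restriction on Im w.\<close>

lemma kern_diagonal_decay:
  fixes lam :: "complex ^ 'n::finite" and R :: real
  shows "eventually (\<lambda>\<tau>. \<forall>w t. norm w \<le> R \<longrightarrow> \<bar>t\<bar> = \<tau> \<longrightarrow>
    norm (kern lam w (Complex (- \<tau>) t)) \<le> exp (- \<tau>)) at_top"
proof -
  define n where "n = real CARD('n)"
  define q where "q = n * (0 - 1/2) - Re (\<Sum>l\<in>UNIV. lam $ l)"
  have n: "n \<ge> 1" by (simp add: n_def)
  obtain C T where C: "C > 0" "T \<ge> 4" and bd: "\<And>u t. u \<le> 0 \<Longrightarrow> T \<le> \<bar>t\<bar> \<Longrightarrow>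
    norm (Gamma_prod lam (Complex u t)) \<le> C * \<bar>t\<bar> powr q * (\<bar>t\<bar> / 2) powr (n * (u - 0)) *
      exp (- (n * pi * \<bar>t\<bar> / 2))"
    using norm_Gamma_prod_le[of 0 lam] unfolding n_def q_def by blast
  have "((\<lambda>\<tau>. C * \<tau> powr q / exp \<tau>) \<longlongrightarrow> 0) at_top"
    by real_asymp
  then have "eventually (\<lambda>\<tau>. C * \<tau> powr q / exp \<tau> < 1) at_top"
    by (rule order_tendstoD) simp
  \<comment> \<open>For \<tau>/2 \<ge> exp(2 R + 2) the superexponential factor is at most exp(- n
    \<tau> (2 R + 2)). After the factor exp(2 n \<tau> R) this leaves exp(-2 n \<tau>); replacing C
    \<tau>^q by exp(\<tau>) still leaves exp(-\<tau>), as n \<ge> 1.\<close>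
  then have "eventually (\<lambda>\<tau>. C * \<tau> powr q / exp \<tau> < 1 \<and> T \<le> \<tau> \<and> 2 * exp (2 * R + 2) \<le> \<tau>) at_top"
    by (intro eventually_conj eventually_ge_at_top)
  then show ?thesis
  proof (rule eventually_mono, intro allI impI)
    fix \<tau> t :: real and w :: complex assume \<tau>: "C * \<tau> powr q / exp \<tau> < 1 \<and> T \<le> \<tau> \<and> 2 * exp (2 * R + 2) \<le> \<tau>"
      and w: "norm w \<le> R" and t: "\<bar>t\<bar> = \<tau>"
    define s where "s = Complex (- \<tau>) t"
    have \<tau>0: "\<tau> > 0" using \<tau> C by simp
    have "norm s \<le> 2 * \<tau>" using cmod_le[of s] t by (simp add: s_def)
    then have "norm s * norm w \<le> (2 * \<tau>) * R" using w \<tau>0 by (intro mult_mono) auto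
    then have "n * (norm s * norm w) \<le> n * (2 * \<tau> * R)" using n by (intro mult_left_mono) auto
    then have e1: "norm (exp (- (of_nat CARD('n) * s * w))) \<le> exp (n * (2 * \<tau> * R))"
      using norm_exp[of "- (of_nat CARD('n) * s * w)"]
      unfolding norm_minus_cancel norm_mult norm_of_nat n_def mult.assoc
      by (meson exp_le_cancel_iff order_trans)
    have "norm (Gamma_prod lam s) \<le> (C * \<tau> powr q) * (\<tau> / 2) powr (n * (- \<tau>)) * exp (- (n * pi * \<tau> / 2))"
      using bd[of "- \<tau>" t] \<tau> \<tau>0 t by (simp add: s_def)
    also have "\<dots> \<le> exp \<tau> * exp (2 * R + 2) powr (n * (- \<tau>)) * 1"
      using \<tau> \<tau>0 n by (intro mult_mono powr_mono2') (auto simp: divide_less_eq mult_nonneg_nonpos)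
    also have "\<dots> = exp \<tau> * exp ((2 * R + 2) * (n * (- \<tau>)))"
      by (simp add: powr_def)
    finally have "norm (Gamma_prod lam s) * norm (exp (- (of_nat CARD('n) * s * w))) \<le>
        exp \<tau> * exp ((2 * R + 2) * (n * (- \<tau>))) * exp (n * (2 * \<tau> * R))"
      using e1 by (intro mult_mono) auto
    also have "\<dots> = exp (\<tau> - 2 * (n * \<tau>))"
      by (simp add: algebra_simps flip: exp_add)
    also have "\<dots> \<le> exp (- \<tau>)"
      using n \<tau>0 mult_right_mono[of 1 n \<tau>] by simp
    finally show "norm (kern lam w (Complex (- \<tau>) t)) \<le> exp (- \<tau>)"
      by (simp add: kern_def norm_mult s_def)
  qed
qed

lemma kern_continuous_on:
  "S \<inter> poles lam = {} \<Longrightarrow> continuous_on S (kern lam w)"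
  by (intro holomorphic_on_imp_continuous_on kern_holomorphic)

lemma half_planes_no_poles:
  "{s. pole_box lam < Im s} \<inter> poles lam = {}"
  "{s. Im s < - pole_box lam} \<inter> poles lam = {}"
  "{s. pole_box lam < Re s} \<inter> poles lam = {}"
  using Re_pole_le[of _ lam] abs_Im_pole_le[of _ lam] by fastforce+

text \<open>Each truncated integral is entire in w, being taken over compact segments. Successive
  differences are two short diagonal integrals, summably small on every disc, so the limit is
  locally uniform and therefore entire.\<close>

lemma kern_entire_limit:
  fixes lam :: "complex ^ 'n::finite" and A :: real
  assumes "pole_box lam < A"
  obtains F where "F holomorphic_on UNIV"
    "\<And>w. (\<lambda>m. box_integral (kern lam w) A (real m)) \<longlonglongrightarrow> F w"
proof -
  define b where "b = pole_box lam"
  \<comment> \<open>From this index on the horizontal sides lie outside the strip that contains the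
    poles, so no segment of the path meets one.\<close>
  obtain m0 :: nat where m0: "b < real m0" using reals_Archimedean2 by blast
  define f where "f i w = box_integral (kern lam w) A (real (m0 + i))" for i w
  define D where "D i w = f (Suc i) w - f i w" for i w
  have hol: "f i holomorphic_on UNIV" for i
  proof -
    have G: "continuous_on S (Gamma_prod lam)" if "S \<inter> poles lam = {}" for S
      using kern_continuous_on[OF that, of 0] by (simp add: kern_def[abs_def])
    have "closed_segment (Complex (- m) (- m)) (Complex A (- m)) \<inter> poles lam = {}"
      "closed_segment (Complex A (- m)) (Complex A m) \<inter> poles lam = {}"
      "closed_segment (Complex A m) (Complex (- m) m) \<inter> poles lam = {}" if "b < m" for m
    proof -
      have "closed_segment (Complex (- m) (- m)) (Complex A (- m)) \<subseteq> {s. Im s < - b}"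
        "closed_segment (Complex A (- m)) (Complex A m) \<subseteq> {s. b < Re s}"
        "closed_segment (Complex A m) (Complex (- m) m) \<subseteq> {s. b < Im s}"
        using that assms
        by (intro closed_segment_subset convex_open_half_planes; simp add: b_def)+
      then show "closed_segment (Complex (- m) (- m)) (Complex A (- m)) \<inter> poles lam = {}"
        "closed_segment (Complex A (- m)) (Complex A m) \<inter> poles lam = {}"
        "closed_segment (Complex A m) (Complex (- m) m) \<inter> poles lam = {}"
        using half_planes_no_poles[of lam] unfolding b_def by blast+
    qed
    from this[of "real (m0 + i)"] m0 show ?thesis
      unfolding f_def box_integral_def kern_def
      by (intro holomorphic_on_add holomorphic_on_linepath_integral G) auto
  qed
  \<comment> \<open>The index from which the bound holds depends on R, which is why the eventual
    form of the Weierstrass test is used. The 4 comes from two diagonal segments, each of length at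
    most 2.\<close>
  have diag: "eventually (\<lambda>i. \<forall>w\<in>cball (0::complex) R. norm (D i w) \<le> 4 * exp (- real (m0 + i))) sequentially" for R
  proof -
    obtain T where T: "\<And>\<tau> (w::complex) t. T \<le> \<tau> \<Longrightarrow> norm w \<le> R \<Longrightarrow> \<bar>t\<bar> = \<tau> \<Longrightarrow>
        norm (kern lam w (Complex (- \<tau>) t)) \<le> exp (- \<tau>)"
      using kern_diagonal_decay[where lam = lam and R = R] unfolding eventually_at_top_linorder by blast
    have "eventually (\<lambda>i::nat. T \<le> real i) sequentially"
      by real_asymp
    then show ?thesis
    proof (rule eventually_mono, intro ballI)
      fix i :: nat and w :: complex assume i: "T \<le> real i" and w: "w \<in> cball 0 R"
      let ?m = "real (m0 + i)" let ?k = "kern lam w"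
      have seg: "\<exists>\<tau>\<ge>?m. s = Complex (- \<tau>) (c * \<tau>)"
        if sg: "s \<in> closed_segment (Complex (- ?m) (c * ?m)) (Complex (- (?m + 1)) (c * (?m + 1)))"
        for s c
      proof -
        obtain u where u: "0 \<le> u" "u \<le> 1" "s = (1 - u) *\<^sub>R Complex (- ?m) (c * ?m) +
            u *\<^sub>R Complex (- (?m + 1)) (c * (?m + 1))"
          using iffD1[OF in_segment(1) sg] by metis
        then have "s = Complex (- (?m + u)) (c * (?m + u))"
          by (simp add: complex_eq_iff algebra_simps)
        then show ?thesis using u by (intro exI[of _ "?m + u"]) auto
      qed
      have bound: "norm (?k s) \<le> exp (- ?m)"
        if sg: "s \<in> closed_segment (Complex (- ?m) (c * ?m)) (Complex (- (?m + 1)) (c * (?m + 1)))"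
          and c: "c = 1 \<or> c = -1" for s c
      proof -
        obtain \<tau> where \<tau>: "\<tau> \<ge> ?m" "s = Complex (- \<tau>) (c * \<tau>)" using seg[OF sg] by blast
        have "norm (?k s) \<le> exp (- \<tau>)"
          unfolding \<tau>(2) using c \<tau>(1) i w by (intro T) (auto simp: abs_mult)
        then show ?thesis using \<tau>(1) by (meson exp_le_cancel_iff neg_le_iff_le order_trans)
      qed
      have integr: "?k contour_integrable_on linepath x y"
        if "closed_segment x y \<inter> poles lam = {}" for x y
        using that by (intro contour_integrable_continuous_linepath kern_continuous_on)
      have len: "norm (Complex x y) \<le> 2" if "\<bar>x\<bar> \<le> 1" "\<bar>y\<bar> \<le> 1" for x y
        using cmod_le[of "Complex x y"] that by simp
      have l: "norm (contour_integral (linepath (Complex (- (?m + 1)) (- (?m + 1))) (Complex (- ?m) (- ?m))) ?k)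
          \<le> exp (- ?m) * norm (Complex (- ?m) (- ?m) - Complex (- (?m + 1)) (- (?m + 1)))"
      proof (rule contour_integral_bound_linepath)
        have "closed_segment (Complex (- (?m + 1)) (- (?m + 1))) (Complex (- ?m) (- ?m)) \<subseteq> {s. Im s < - b}"
          using m0 by (intro closed_segment_subset convex_open_half_planes) auto
        then show "?k contour_integrable_on linepath (Complex (- (?m + 1)) (- (?m + 1))) (Complex (- ?m) (- ?m))"
          using half_planes_no_poles[of lam] unfolding b_def by (intro integr) blast
      qed (use bound[of _ "-1"] in \<open>auto simp: closed_segment_commute\<close>)
      have u: "norm (contour_integral (linepath (Complex (- ?m) ?m) (Complex (- (?m + 1)) (?m + 1))) ?k)
          \<le> exp (- ?m) * norm (Complex (- (?m + 1)) (?m + 1) - Complex (- ?m) ?m)"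
      proof (rule contour_integral_bound_linepath)
        have "closed_segment (Complex (- ?m) ?m) (Complex (- (?m + 1)) (?m + 1)) \<subseteq> {s. b < Im s}"
          using m0 by (intro closed_segment_subset convex_open_half_planes) auto
        then show "?k contour_integrable_on linepath (Complex (- ?m) ?m) (Complex (- (?m + 1)) (?m + 1))"
          using half_planes_no_poles[of lam] unfolding b_def by (intro integr) blast
      qed (use bound[of _ 1] in auto)
      have "D i w = contour_integral (linepath (Complex (- (?m + 1)) (- (?m + 1))) (Complex (- ?m) (- ?m))) ?k +
          contour_integral (linepath (Complex (- ?m) ?m) (Complex (- (?m + 1)) (?m + 1))) ?k"
        using box_integral_diff[of ?k b A ?m "?m + 1"] half_planes_no_poles[of lam] m0 assms
        unfolding D_def f_def b_def by (simp add: kern_holomorphic add_ac)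
      also have "norm \<dots> \<le> exp (- ?m) * norm (Complex 1 1) + exp (- ?m) * norm (Complex (- 1) 1)"
        by (intro order_trans[OF norm_triangle_ineq] add_mono order_trans[OF l] order_trans[OF u])
          (simp_all add: minus_complex.code)
      also have "\<dots> \<le> exp (- ?m) * 2 + exp (- ?m) * 2"
        by (intro add_mono mult_left_mono len) auto
      finally show "norm (D i w) \<le> 4 * exp (- ?m)" by simp
    qed
  qed
  have summ: "summable (\<lambda>i. 4 * exp (- real (m0 + i)))"
  proof -
    have "summable (\<lambda>i. (4 * exp (- real m0)) * exp (- 1) ^ i)"
      by (intro summable_mult summable_geometric) simp
    moreover have "(4 * exp (- real m0)) * exp (- 1) ^ i = 4 * exp (- real (m0 + i))" for i
      by (simp add: exp_add[symmetric] exp_of_nat_mult[symmetric])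
    ultimately show ?thesis by simp
  qed
  define F where "F w = f 0 w + (\<Sum>i. D i w)" for w
  have tel: "f N w = f 0 w + (\<Sum>i<N. D i w)" for N w
    using sum_lessThan_telescope[of "\<lambda>i. f i w" N] by (simp add: D_def)
  have unif: "uniform_limit (cball 0 R) f F sequentially" for R
  proof -
    have "uniform_limit (cball 0 R) (\<lambda>N w. \<Sum>i<N. D i w) (\<lambda>w. \<Sum>i. D i w) sequentially"
      using diag summ by (rule Weierstrass_m_test_ev)
    then have "uniform_limit (cball 0 R) (\<lambda>N w. f 0 w + (\<Sum>i<N. D i w)) (\<lambda>w. f 0 w + (\<Sum>i. D i w)) sequentially"
      by (intro uniform_limit_intros)
    then show ?thesis by (simp only: tel[symmetric] F_def[symmetric])
  qed
  have "F holomorphic_on UNIV"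
  proof (rule holomorphic_uniform_sequence[OF open_UNIV hol])
    fix x :: complex
    have "cball x 1 \<subseteq> cball 0 (norm x + 1)" by (simp add: cball_subset_cball_iff)
    then show "\<exists>d>0. cball x d \<subseteq> UNIV \<and> uniform_limit (cball x d) f F sequentially"
      using uniform_limit_on_subset[OF unif] by (intro exI[of _ 1]) auto
  qed
  moreover have "(\<lambda>m. box_integral (kern lam w) A (real m)) \<longlonglongrightarrow> F w" for w
  proof -
    have "(\<lambda>i. f i w) \<longlonglongrightarrow> F w"
      using tendsto_uniform_limitI[OF unif[of "norm w"]] by simp
    then have "(\<lambda>i. box_integral (kern lam w) A (real (i + m0))) \<longlonglongrightarrow> F w"
      by (simp add: f_def add.commute)
    then show ?thesis by (rule LIMSEQ_offset)
  qed
  ultimately show ?thesis using that by blast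
qed

section \<open>Integrals along rays and segments\<close>

text \<open>For |Im w| \<le> \<pi>/2 the growth exp(n t Im w) is at most the reciprocal of the
  exponential decay of the Gamma factors, and a pure power remains. The growth exp(n (\<sigma> - u)
  |Re w|) towards the left is cancelled by (|t|/2)^(n (u - \<sigma>)) once |t|/2 \<ge> exp |Re w|;
  hence the bound is uniform in u \<le> \<sigma>.\<close>

lemma kern_left_bound:
  fixes lam :: "complex ^ 'n::finite" and \<sigma> :: real
  assumes "\<bar>Im w\<bar> \<le> pi / 2"
  shows "\<exists>C T. C > 0 \<and> T \<ge> 4 \<and> (\<forall>u t. u \<le> \<sigma> \<longrightarrow> T \<le> \<bar>t\<bar> \<longrightarrow>
    norm (kern lam w (Complex u t)) \<le>
      C * \<bar>t\<bar> powr (real CARD('n) * (\<sigma> - 1/2) - Re (\<Sum>l\<in>UNIV. lam $ l)))"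
proof -
  define n where "n = real CARD('n)"
  define q where "q = n * (\<sigma> - 1/2) - Re (\<Sum>l\<in>UNIV. lam $ l)"
  define x where "x = \<bar>Re w\<bar>"
  have n: "n \<ge> 1" by (simp add: n_def)
  obtain C T where C: "C > 0" "T \<ge> 4" and bd: "\<And>u t. u \<le> \<sigma> \<Longrightarrow> T \<le> \<bar>t\<bar> \<Longrightarrow>
    norm (Gamma_prod lam (Complex u t)) \<le> C * \<bar>t\<bar> powr q * (\<bar>t\<bar> / 2) powr (n * (u - \<sigma>)) *
      exp (- (n * pi * \<bar>t\<bar> / 2))"
    using norm_Gamma_prod_le[of \<sigma> lam] unfolding n_def q_def by blast
  have "norm (kern lam w (Complex u t)) \<le> C * exp (n * (\<bar>\<sigma>\<bar> * x)) * \<bar>t\<bar> powr q"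
    if u: "u \<le> \<sigma>" and t: "max T (2 * exp x) \<le> \<bar>t\<bar>" for u t
  proof -
    have "4 \<le> \<bar>t\<bar>" using t C by simp
    then have t0: "\<bar>t\<bar> > 0" by linarith
    have "- (u * Re w) \<le> \<bar>u\<bar> * x"
      by (metis abs_ge_minus_self abs_mult x_def)
    also have "\<dots> \<le> (\<bar>\<sigma>\<bar> + (\<sigma> - u)) * x"
      using u by (intro mult_right_mono) (auto simp: x_def)
    finally have 1: "- (u * Re w) \<le> \<bar>\<sigma>\<bar> * x + (\<sigma> - u) * x"
      by (simp add: algebra_simps)
    have 2: "t * Im w \<le> \<bar>t\<bar> * (pi / 2)"
      using mult_left_mono[OF assms, of "\<bar>t\<bar>"] abs_ge_self[of "t * Im w"]
      by (simp add: abs_mult)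
    have "n * (- (u * Re w) + t * Im w) \<le> n * (\<bar>\<sigma>\<bar> * x + (\<sigma> - u) * x + \<bar>t\<bar> * (pi / 2))"
      using 1 2 n by (intro mult_left_mono) auto
    then have "norm (exp (- (of_nat CARD('n) * Complex u t * w))) \<le>
        exp (n * (\<bar>\<sigma>\<bar> * x) + n * ((\<sigma> - u) * x) + n * (\<bar>t\<bar> * (pi / 2)))"
      by (simp add: n_def algebra_simps)
    also have "\<dots> = exp (n * (\<bar>\<sigma>\<bar> * x)) * exp (n * ((\<sigma> - u) * x)) * exp (n * pi * \<bar>t\<bar> / 2)"
      unfolding exp_add by (simp add: mult_ac)
    finally have e1: "norm (exp (- (of_nat CARD('n) * Complex u t * w))) \<le>
      exp (n * (\<bar>\<sigma>\<bar> * x)) * exp (n * ((\<sigma> - u) * x)) * exp (n * pi * \<bar>t\<bar> / 2)" .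
    have "norm (Gamma_prod lam (Complex u t)) \<le>
        C * \<bar>t\<bar> powr q * (\<bar>t\<bar> / 2) powr (n * (u - \<sigma>)) * exp (- (n * pi * \<bar>t\<bar> / 2))"
      using bd u t by simp
    also have "\<dots> \<le> C * \<bar>t\<bar> powr q * exp x powr (n * (u - \<sigma>)) * exp (- (n * pi * \<bar>t\<bar> / 2))"
      using u t n C by (intro mult_right_mono mult_left_mono powr_mono2') (auto simp: mult_nonneg_nonpos)
    also have "exp x powr (n * (u - \<sigma>)) = exp (- (n * ((\<sigma> - u) * x)))"
      by (simp add: powr_def algebra_simps)
    finally have "norm (kern lam w (Complex u t)) \<le>
        (C * \<bar>t\<bar> powr q * exp (- (n * ((\<sigma> - u) * x))) * exp (- (n * pi * \<bar>t\<bar> / 2))) *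
        (exp (n * (\<bar>\<sigma>\<bar> * x)) * exp (n * ((\<sigma> - u) * x)) * exp (n * pi * \<bar>t\<bar> / 2))"
      unfolding kern_def norm_mult using e1 C by (intro mult_mono) auto
    also have "\<dots> = C * exp (n * (\<bar>\<sigma>\<bar> * x)) * \<bar>t\<bar> powr q"
      unfolding exp_minus by (simp add: field_simps)
    finally show ?thesis .
  qed
  then show ?thesis
    unfolding q_def n_def using C
    by (intro exI[of _ "C * exp (n * (\<bar>\<sigma>\<bar> * x))"] exI[of _ "max T (2 * exp x)"])
      (auto simp: n_def)
qed

text \<open>\<open>has_upward_integral\<close> integrates over a whole ray, whereas Cauchy's theorem
  speaks of truncations. Domination by an integrable power makes the integral absolutely convergent,
  and this yields both its existence and the limit of the truncations.\<close>

lemma has_integral_atLeast_of_powr_bound: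
  fixes h :: "real \<Rightarrow> complex"
  assumes cont: "continuous_on {T..} h"
    and bd: "\<And>t. T0 \<le> t \<Longrightarrow> norm (h t) \<le> C * t powr q" and q: "q < -1"
  obtains I where "(h has_integral I) {T..}" "((\<lambda>m. integral {T..m} h) \<longlongrightarrow> I) at_top"
proof -
  define T1 where "T1 = max T (max T0 1)"
  have "h absolutely_integrable_on {T1..}"
  proof (rule measurable_bounded_by_integrable_imp_absolutely_integrable)
    show "h \<in> borel_measurable (lebesgue_on {T1..})"
      by (intro continuous_imp_measurable_on_sets_lebesgue continuous_on_subset[OF cont]) (auto simp: T1_def)
    show "(\<lambda>t. C * t powr q) integrable_on {T1..}"
      using has_integral_integrable[OF has_integral_powr_to_inf[OF q, of T1]]
      by (intro integrable_on_mult_right) (auto simp: T1_def)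
  qed (use bd in \<open>auto simp: T1_def\<close>)
  moreover have "h absolutely_integrable_on {T..T1}"
    by (intro absolutely_integrable_continuous_real continuous_on_subset[OF cont]) auto
  ultimately have "h absolutely_integrable_on ({T..T1} \<union> {T1..})"
    by (intro absolutely_integrable_Un)
  moreover have "{T..T1} \<union> {T1..} = {T..}" by (auto simp: T1_def)
  ultimately have ai: "h absolutely_integrable_on {T..}" by simp
  then have "(h has_integral integral {T..} h) {T..}"
    by (simp add: set_lebesgue_integral_eq_integral(1) integrable_integral)
  moreover have "((\<lambda>m. integral {T..m} h) \<longlongrightarrow> integral {T..} h) at_top"
  proof -
    have "((\<lambda>m. set_lebesgue_integral lebesgue {T..m} h) \<longlongrightarrow> set_lebesgue_integral lebesgue {T..} h) at_top"
      by (intro tendsto_set_lebesgue_integral_at_top ai) auto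
    moreover have "set_lebesgue_integral lebesgue {T..m} h = integral {T..m} h" for m
      by (intro set_lebesgue_integral_eq_integral(2) set_integrable_subset[OF ai]) auto
    ultimately show ?thesis
      using set_lebesgue_integral_eq_integral(2)[OF ai] by simp
  qed
  ultimately show ?thesis using that by blast
qed

text \<open>Over an unbounded set the gauge integral is a limit along large boxes. The reflection of
  a box containing \<open>ball 0 B\<close> contains it again, so the rule for bounded intervals
  passes to the limit.\<close>

lemma has_integral_atMost_reflect:
  fixes h :: "real \<Rightarrow> complex"
  assumes "((\<lambda>t. h (- t)) has_integral I) {T..}"
  shows "(h has_integral I) {..- T}"
proof (subst has_integral', intro allI impI)
  fix \<epsilon> :: real assume "\<epsilon> > 0"
  then obtain B where B: "B > 0" and Bz: "\<And>a b. ball 0 B \<subseteq> cbox a b \<Longrightarrow>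
      \<exists>z. ((\<lambda>t. if t \<in> {T..} then h (- t) else 0) has_integral z) (cbox a b) \<and> norm (z - I) < \<epsilon>"
    using iffD1[OF has_integral' assms] by metis
  have "\<exists>z. ((\<lambda>t. if t \<in> {..- T} then h t else 0) has_integral z) (cbox a b) \<and> norm (z - I) < \<epsilon>"
    if "ball 0 B \<subseteq> cbox a b" for a b
  proof -
    have "ball 0 B \<subseteq> cbox (- b) (- a)"
    proof
      fix t :: real assume "t \<in> ball 0 B"
      then have "- t \<in> cbox a b" using that by (intro subsetD[OF that]) auto
      then show "t \<in> cbox (- b) (- a)" by auto
    qed
    then obtain z where z: "((\<lambda>t. if t \<in> {T..} then h (- t) else 0) has_integral z) (cbox (- b) (- a))"
      "norm (z - I) < \<epsilon>" using Bz by blast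
    have "(\<lambda>t. if t \<in> {T..} then h (- t) else 0) = (\<lambda>t. (\<lambda>t. if t \<in> {..- T} then h t else 0) (- t))"
      by (auto simp: fun_eq_iff)
    with z(1) have "((\<lambda>t. (\<lambda>t. if t \<in> {..- T} then h t else 0) (- t)) has_integral z) (cbox (- b) (- a))"
      by metis
    then have "((\<lambda>t. if t \<in> {..- T} then h t else 0) has_integral z) (cbox a b)"
      by (rule iffD1[OF has_integral_reflect])
    with z(2) show ?thesis by blast
  qed
  with B show "\<exists>B>0. \<forall>a b. ball 0 B \<subseteq> cbox a b \<longrightarrow>
      (\<exists>z. ((\<lambda>t. if t \<in> {..- T} then h t else 0) has_integral z) (cbox a b) \<and> norm (z - I) < \<epsilon>)"
    by blast
qed

lemma has_contour_integral_vertical: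
  assumes "((\<lambda>t. f (Complex \<sigma> t) * \<i>) has_integral I) {a..b}" "a < b"
  shows "(f has_contour_integral I) (linepath (Complex \<sigma> a) (Complex \<sigma> b))"
proof -
  let ?h = "\<lambda>t. f (Complex \<sigma> t) * \<i>"
  have "((\<lambda>x. ?h ((b - a) *\<^sub>R x + a)) has_integral I /\<^sub>R (b - a)) {0..1}"
    using has_integral_affinity'[of ?h I a b "b - a" a] assms by simp
  then have "((\<lambda>x. (b - a) *\<^sub>R ?h ((b - a) *\<^sub>R x + a)) has_integral (b - a) *\<^sub>R (I /\<^sub>R (b - a))) {0..1}"
    by (rule has_integral_cmul)
  moreover have "linepath (Complex \<sigma> a) (Complex \<sigma> b) x = Complex \<sigma> ((b - a) *\<^sub>R x + a)" for x
    by (simp add: linepath_def complex_eq_iff algebra_simps)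
  moreover have "Complex \<sigma> b - Complex \<sigma> a = of_real (b - a) * \<i>"
    by (simp add: complex_eq_iff)
  ultimately show ?thesis
    using assms(2) by (simp add: has_contour_integral_linepath scaleR_conv_of_real mult_ac)
qed

text \<open>The segment has length at most 2 m and the integrand is O(m^q), so q < -1 suffices. This
  is what allows the vertical ends to be traded for bent ones, with c = 1 for the upper and c = -1
  for the lower end.\<close>

lemma kern_horizontal_tendsto_0:
  fixes lam :: "complex ^ 'n::finite" and \<sigma> :: real
  assumes w: "\<bar>Im w\<bar> \<le> pi / 2"
    and q: "real CARD('n) * (\<sigma> - 1/2) - Re (\<Sum>l\<in>UNIV. lam $ l) < -1" and c: "\<bar>c\<bar> = 1"
  shows "(\<lambda>m. contour_integral (linepath (Complex \<sigma> (c * real m)) (Complex (- real m) (c * real m))) (kern lam w))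
    \<longlonglongrightarrow> 0"
proof -
  define q where "q = real CARD('n) * (\<sigma> - 1/2) - Re (\<Sum>l\<in>UNIV. lam $ l)"
  obtain C T where C: "C > 0" "T \<ge> 4" and bd: "\<And>u t. u \<le> \<sigma> \<Longrightarrow> T \<le> \<bar>t\<bar> \<Longrightarrow>
    norm (kern lam w (Complex u t)) \<le> C * \<bar>t\<bar> powr q"
    using kern_left_bound[OF w, of \<sigma> lam] unfolding q_def by blast
  show ?thesis
  proof (rule Lim_null_comparison)
    have "((\<lambda>m. 2 * C * m powr (q + 1)) \<longlongrightarrow> 0) at_top"
      using q by (intro tendsto_mult_right_zero tendsto_neg_powr) (auto simp: q_def filterlim_ident)
    then show "(\<lambda>m. 2 * C * real m powr (q + 1)) \<longlonglongrightarrow> 0"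
      by (rule filterlim_compose) (rule filterlim_real_sequentially)
    have "eventually (\<lambda>m::nat. max T (max \<bar>\<sigma>\<bar> (pole_box lam + 1)) \<le> real m) sequentially"
      by real_asymp
    then show "eventually (\<lambda>m. norm (contour_integral
        (linepath (Complex \<sigma> (c * real m)) (Complex (- real m) (c * real m))) (kern lam w)) \<le>
        2 * C * real m powr (q + 1)) sequentially"
    proof (rule eventually_mono)
      fix m :: nat assume m: "max T (max \<bar>\<sigma>\<bar> (pole_box lam + 1)) \<le> real m"
      let ?a = "Complex \<sigma> (c * real m)" and ?b = "Complex (- real m) (c * real m)"
      have "- real m \<le> \<sigma>" using m by linarith
      then have seg: "Re s \<le> \<sigma> \<and> Im s = c * real m" if "s \<in> closed_segment ?a ?b" for s
        using that by (simp add: closed_segment_same_Im closed_segment_eq_real_ivl split: if_splits)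
      have cm: "\<bar>c * real m\<bar> = real m" using c by (simp add: abs_mult)
      have "norm (contour_integral (linepath ?a ?b) (kern lam w)) \<le> (C * real m powr q) * norm (?b - ?a)"
      proof (rule contour_integral_bound_linepath)
        have "closed_segment ?a ?b \<inter> poles lam = {}"
          using seg cm m abs_Im_pole_le[of _ lam] by fastforce
        then show "kern lam w contour_integrable_on linepath ?a ?b"
          by (intro contour_integrable_continuous_linepath kern_continuous_on)
        show "norm (kern lam w s) \<le> C * real m powr q" if "s \<in> closed_segment ?a ?b" for s
          using bd[of "Re s" "Im s"] seg[OF that] cm m by (simp del: complex.collapse) (metis complex.collapse)
      qed (use C in auto)
      also have "norm (?b - ?a) = \<bar>- real m - \<sigma>\<bar>"
        by (simp add: cmod_def)
      also have "(C * real m powr q) * \<bar>- real m - \<sigma>\<bar> \<le> (C * real m powr q) * (2 * real m)"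
        using m C by (intro mult_left_mono) auto
      also have "\<dots> = 2 * C * real m powr (q + 1)"
        using m C unfolding powr_add by simp
      finally show "norm (contour_integral (linepath ?a ?b) (kern lam w)) \<le> 2 * C * real m powr (q + 1)" .
    qed
  qed
qed

section \<open>Moving the contour\<close>

text \<open>
  The path \<open>\<gamma>\<close> (the given contour up to height \<open>m\<close>) and the path \<open>\<rho>\<close> (three sides of a rectangle) are
  both closed up by the same arc \<open>\<alpha>\<close> around the left. A pole can then be moved to a far left point \<open>q\<close>
  avoiding each closed path separately, although perhaps not both at once; and \<open>\<gamma>\<close> minus \<open>\<rho>\<close> does not
  wind around \<open>q\<close>.
\<close>

lemma truncated_contour_eq_box:
  fixes P :: "complex set"
  assumes up: "upward_contour \<sigma> T g"
    and left: "P \<subseteq> left_of_contour \<sigma> T g"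
    and P: "closed P" "\<And>r. finite {p \<in> P. r < Re p}"
    and b: "\<And>p. p \<in> P \<Longrightarrow> Re p \<le> b" "\<And>p. p \<in> P \<Longrightarrow> \<bar>Im p\<bar> \<le> b" "b < A"
    and f: "f holomorphic_on - P"
  shows "eventually (\<lambda>m.
    contour_integral (linepath (Complex \<sigma> (- m)) (Complex \<sigma> (- T))) f + contour_integral g f +
      contour_integral (linepath (Complex \<sigma> T) (Complex \<sigma> m)) f =
    contour_integral (linepath (Complex \<sigma> (- m)) (Complex A (- m))) f +
      contour_integral (linepath (Complex A (- m)) (Complex A m)) f +
      contour_integral (linepath (Complex A m) (Complex \<sigma> m)) f) at_top"
proof -
  define K where "K = contour_image \<sigma> T g"
  have T: "0 < T" and g: "valid_path g" "pathstart g = Complex \<sigma> (- T)" "pathfinish g = Complex \<sigma> T"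
    using up by (auto simp: upward_contour_def)
  have ray: "closed (Complex \<sigma> ` S)" if "closed S" for S
  proof -
    have "Complex \<sigma> ` S = {s. Re s = \<sigma>} \<inter> Im -` S"
      by (auto simp: image_iff complex_eq_iff)
    then show ?thesis
      using that by (auto intro!: closed_Int closed_vimage closed_Collect_eq continuous_intros)
  qed
  have openK: "open (- K)"
    unfolding K_def contour_image_def open_Compl
    using valid_path_imp_path[OF g(1)] ray by (auto intro!: closed_Un closed_path_image open_Compl)
  obtain B where B: "\<And>s. s \<in> path_image g \<Longrightarrow> norm s \<le> B"
    using bounded_path_image[OF valid_path_imp_path[OF g(1)]] unfolding bounded_iff by blast
  \<comment> \<open>The point r lies to the left of the given contour and of every rectangle path
    \<rho>, so their difference has index 0 about all points with real part at most r.\<close>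
  define r where "r = - (\<bar>B\<bar> + \<bar>\<sigma>\<bar> + \<bar>A\<bar> + 1)"
  define q where "q = complex_of_real r"
  have Kr: "r < Re s" if "s \<in> K" for s
    using that B[of s] abs_Re_le_cmod[of s] by (auto simp: K_def contour_image_def r_def)
  define \<gamma> where "\<gamma> m = linepath (Complex \<sigma> (- m)) (Complex \<sigma> (- T)) +++ g +++ linepath (Complex \<sigma> T) (Complex \<sigma> m)" for m
  define \<rho> where "\<rho> m = linepath (Complex \<sigma> (- m)) (Complex A (- m)) +++ linepath (Complex A (- m)) (Complex A m) +++
      linepath (Complex A m) (Complex \<sigma> m)" for m
  define \<alpha> where "\<alpha> m = linepath (Complex \<sigma> m) (Complex (- m) m) +++ linepath (Complex (- m) m) (Complex (- m) (- m)) +++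
      linepath (Complex (- m) (- m)) (Complex \<sigma> (- m))" for m
  have valid: "valid_path (\<gamma> m)" "valid_path (\<rho> m)" "valid_path (\<alpha> m)" for m
    unfolding \<gamma>_def \<rho>_def \<alpha>_def using g by (auto intro!: valid_path_join)
  have ends: "pathstart (\<gamma> m) = Complex \<sigma> (- m)" "pathfinish (\<gamma> m) = Complex \<sigma> m"
    "pathstart (\<rho> m) = Complex \<sigma> (- m)" "pathfinish (\<rho> m) = Complex \<sigma> m"
    "pathstart (\<alpha> m) = Complex \<sigma> m" "pathfinish (\<alpha> m) = Complex \<sigma> (- m)" for m
    unfolding \<gamma>_def \<rho>_def \<alpha>_def by simp_all
  have img\<gamma>: "path_image (\<gamma> m) \<subseteq> K" if "T \<le> m" for m
  proof -
    have "closed_segment (Complex \<sigma> (- m)) (Complex \<sigma> (- T)) \<subseteq> Complex \<sigma> ` {..- T}"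
      "closed_segment (Complex \<sigma> T) (Complex \<sigma> m) \<subseteq> Complex \<sigma> ` {T..}"
      using that by (auto simp: closed_segment_same_Re closed_segment_eq_real_ivl image_iff complex_eq_iff split: if_splits)
    then show ?thesis
      unfolding \<gamma>_def K_def contour_image_def using g by (auto simp: path_image_join)
  qed
  have img\<rho>: "\<bar>Im s\<bar> = m \<or> Re s = A" "r < Re s" if "s \<in> path_image (\<rho> m)" "0 < m" for s m
    using that unfolding \<rho>_def r_def
    by (auto simp: path_image_join closed_segment_same_Re closed_segment_same_Im closed_segment_eq_real_ivl split: if_splits)
  have img\<alpha>: "\<bar>Im s\<bar> = m \<or> Re s = - m" if "s \<in> path_image (\<alpha> m)" "0 < m" for s m
    using that unfolding \<alpha>_def
    by (auto simp: path_image_join closed_segment_same_Re closed_segment_same_Im split: if_splits)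
  define \<delta> where "\<delta> m = \<gamma> m +++ reversepath (\<rho> m)" for m
  have valid\<delta>: "valid_path (\<delta> m)" "pathfinish (\<delta> m) = pathstart (\<delta> m)" for m
    unfolding \<delta>_def using valid ends by (auto intro!: valid_path_join)
  have img\<delta>: "path_image (\<delta> m) = path_image (\<gamma> m) \<union> path_image (\<rho> m)" for m
    unfolding \<delta>_def using ends by (simp add: path_image_join)
  have \<delta>r: "path_image (\<delta> m) \<subseteq> {s. r < Re s}" if "T \<le> m" for m
    using img\<delta>[of m] img\<gamma>[OF that] img\<rho>(2)[of _ m] Kr T that by auto
  have far: "winding_number (\<delta> m) p = 0" if "Re p \<le> r" "T \<le> m" for p m
    using that \<delta>r[of m] valid\<delta> convex_open_half_planes
    by (intro winding_number_zero_outside[where s = "{s. r < Re s}"]) (auto intro: valid_path_imp_path)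
  have notK: "p \<notin> K" if p: "p \<in> P" for p
  proof -
    obtain r' where "\<And>s. Re s \<le> r' \<Longrightarrow> connected_component (- K) p s"
      using p left unfolding left_of_contour_def K_def by blast
    from this[of "of_real r'"] show ?thesis using connected_component_in by fastforce
  qed
  \<comment> \<open>Adding and subtracting the index of \<alpha> splits the index of the difference
    into those of two closed paths; each of these is constant along its own connected set from p to
    q.\<close>
  have wn: "winding_number (\<delta> m) s = (winding_number (\<gamma> m) s + winding_number (\<alpha> m) s) -
      (winding_number (\<rho> m) s + winding_number (\<alpha> m) s)"
    if "s \<notin> path_image (\<gamma> m)" "s \<notin> path_image (\<rho> m)" for s m
    unfolding \<delta>_def using valid ends that
    by (subst winding_number_join) (auto intro: valid_path_imp_path simp: winding_number_reversepath valid_path_imp_path)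
  have near: "eventually (\<lambda>m. winding_number (\<delta> m) p = 0) at_top" if p: "p \<in> P" "r < Re p" for p
  proof -
    obtain r' where r': "\<And>s. Re s \<le> r' \<Longrightarrow> connected_component (- K) p s"
      using p left unfolding left_of_contour_def K_def by blast
    have "connected_component (- K) p (of_real (min r r'))"
      by (rule r') simp
    moreover have "connected_component (- K) (of_real (min r r')) q"
      unfolding connected_component_def
    proof (intro exI conjI)
      show "connected {s. Re s \<le> r}" by (intro convex_connected convex_halfspace_Re_le)
    qed (use Kr in \<open>force simp: q_def\<close>)+
    ultimately have "connected_component (- K) p q"
      by (rule connected_component_trans)
    then have "path_component (- K) p q"
      by (simp add: open_path_connected_component[OF openK])
    then obtain c where c: "path c" "path_image c \<subseteq> - K" "pathstart c = p" "pathfinish c = q"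
      unfolding path_component_def by blast
    obtain M where M: "\<And>s. s \<in> path_image c \<Longrightarrow> norm s \<le> M"
      using bounded_path_image[OF c(1)] unfolding bounded_iff by blast
    \<comment> \<open>Here m > M keeps \<alpha> away from the path c, which stays within radius M.
      The remaining bounds place p and q inside the rectangle enclosed by \<rho> and
      \<alpha>.\<close>
    have "eventually (\<lambda>m. Max {T, M, - r, b, A} < m) at_top"
      by (rule eventually_gt_at_top)
    then show ?thesis
    proof (rule eventually_mono)
      fix m assume "Max {T, M, - r, b, A} < m"
      then have m: "T < m" "M < m" "- r < m" "b < m" "A < m" by simp_all
      then have m0: "0 < m" using T by simp
      have pathc: "s \<notin> path_image (\<gamma> m) \<union> path_image (\<alpha> m)" if "s \<in> path_image c" for s
      proof -
        have "s \<notin> path_image (\<alpha> m)"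
          using img\<alpha>[OF _ m0, of s] M[OF that] m m0 abs_Re_le_cmod[of s] abs_Im_le_cmod[of s] by fastforce
        then show ?thesis using img\<gamma>[of m] m c(2) that by auto
      qed
      define S where "S = {s. - m < Re s \<and> Re s < A \<and> - m < Im s \<and> Im s < m}"
      have S: "convex S"
        unfolding S_def Collect_conj_eq
        by (intro convex_Int convex_halfspace_Re_gt convex_halfspace_Re_lt convex_halfspace_Im_gt convex_halfspace_Im_lt)
      have pq: "p \<in> path_image c" "q \<in> path_image c" using c by force+
      have pS: "p \<in> S" using p b(1,2)[OF p(1)] b(3) m by (auto simp: S_def)
      have qS: "q \<in> S" using m m0 by (auto simp: S_def q_def r_def)
      have notS: "S \<inter> (path_image (\<rho> m) \<union> path_image (\<alpha> m)) = {}"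
        using img\<rho>(1)[OF _ m0] img\<alpha>[OF _ m0] by (fastforce simp: S_def)
      have join1: "winding_number (\<gamma> m +++ \<alpha> m) s = winding_number (\<gamma> m) s + winding_number (\<alpha> m) s"
        if "s \<in> path_image c" for s
        using pathc[OF that] valid ends by (intro winding_number_join) (auto intro: valid_path_imp_path)
      have join2: "winding_number (\<rho> m +++ \<alpha> m) s = winding_number (\<rho> m) s + winding_number (\<alpha> m) s"
        if "s \<in> S" for s
        using notS that valid ends by (intro winding_number_join) (auto intro: valid_path_imp_path)
      have "winding_number (\<gamma> m +++ \<alpha> m) p = winding_number (\<gamma> m +++ \<alpha> m) q"
      proof (rule winding_number_eq[where S = "path_image c"])
        show "path_image c \<inter> path_image (\<gamma> m +++ \<alpha> m) = {}"
          using pathc ends by (auto simp: path_image_join)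
      qed (use pq valid ends c in \<open>auto intro: valid_path_imp_path connected_path_image\<close>)
      moreover have "winding_number (\<rho> m +++ \<alpha> m) p = winding_number (\<rho> m +++ \<alpha> m) q"
      proof (rule winding_number_eq[where S = S])
        show "S \<inter> path_image (\<rho> m +++ \<alpha> m) = {}"
          using notS ends by (auto simp: path_image_join)
      qed (use pS qS valid ends S in \<open>auto intro: valid_path_imp_path convex_connected\<close>)
      ultimately have "winding_number (\<delta> m) p = winding_number (\<delta> m) q"
        using pathc pq pS qS notS by (subst (1 2) wn) (auto simp: join1 join2)
      also have "\<dots> = 0"
        using m by (intro far) (auto simp: q_def)
      finally show "winding_number (\<delta> m) p = 0" .
    qed
  qed
  \<comment> \<open>The threshold in \<open>near\<close> depends on the pole. Only finitely many
    poles lie to the right of r, so one threshold serves them all; the others are covered by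
    \<open>far\<close>.\<close>
  have "eventually (\<lambda>m. \<forall>p\<in>{p \<in> P. r < Re p}. winding_number (\<delta> m) p = 0) at_top"
    using near P(2)[of r] by (intro eventually_ball_finite) auto
  moreover have "eventually (\<lambda>m. max T b < m) at_top"
    by (rule eventually_gt_at_top)
  ultimately show ?thesis
  proof (rule eventually_elim2)
    fix m assume zero: "\<forall>p\<in>{p \<in> P. r < Re p}. winding_number (\<delta> m) p = 0" and m: "max T b < m"
    have m0: "0 < m" using T m by simp
    have sub\<gamma>: "path_image (\<gamma> m) \<subseteq> - P"
      using img\<gamma>[of m] notK m by auto
    have sub\<rho>: "path_image (\<rho> m) \<subseteq> - P"
    proof
      fix s assume "s \<in> path_image (\<rho> m)"
      then show "s \<in> - P" using img\<rho>(1)[OF _ m0, of s] b(1,2)[of s] b(3) m by auto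
    qed
    have "(f has_contour_integral 0) (\<delta> m)"
    proof (rule Cauchy_theorem_global[OF _ f valid\<delta>])
      show "open (- P)" using P(1) by auto
      show "path_image (\<delta> m) \<subseteq> - P" using img\<delta> sub\<gamma> sub\<rho> by auto
      show "winding_number (\<delta> m) p = 0" if "p \<notin> - P" for p
        using that zero far[of p m] m by (cases "r < Re p") auto
    qed
    then have *: "contour_integral (\<delta> m) f = 0" by (rule contour_integral_unique)
    have integrable: "f contour_integrable_on h" if "valid_path h" "path_image h \<subseteq> - P" for h
      using that P(1) by (intro contour_integrable_holomorphic_simple[OF f]) auto
    have "f contour_integrable_on \<gamma> m" "f contour_integrable_on \<rho> m"
      using integrable valid sub\<gamma> sub\<rho> by auto
    then have "contour_integral (\<gamma> m) f = contour_integral (\<rho> m) f"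
      using * valid ends unfolding \<delta>_def
      by (simp add: contour_integral_reversepath contour_integrable_reversepath)
    moreover have "contour_integral (\<gamma> m) f =
        contour_integral (linepath (Complex \<sigma> (- m)) (Complex \<sigma> (- T))) f + contour_integral g f +
          contour_integral (linepath (Complex \<sigma> T) (Complex \<sigma> m)) f"
      using sub\<gamma> g unfolding \<gamma>_def
      by (subst contour_integral_join contour_integral_join contour_integrable_joinI |
          auto intro!: integrable contour_integrable_joinI valid_path_join simp: path_image_join)+
    moreover have "contour_integral (\<rho> m) f =
        contour_integral (linepath (Complex \<sigma> (- m)) (Complex A (- m))) f +
          contour_integral (linepath (Complex A (- m)) (Complex A m)) f +
          contour_integral (linepath (Complex A m) (Complex \<sigma> m)) f"
      using sub\<rho> unfolding \<rho>_def
      by (subst contour_integral_join contour_integral_join contour_integrable_joinI |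
          auto intro!: integrable contour_integrable_joinI valid_path_join simp: path_image_join)+
    ultimately show "contour_integral (linepath (Complex \<sigma> (- m)) (Complex \<sigma> (- T))) f + contour_integral g f +
      contour_integral (linepath (Complex \<sigma> T) (Complex \<sigma> m)) f =
    contour_integral (linepath (Complex \<sigma> (- m)) (Complex A (- m))) f +
      contour_integral (linepath (Complex A (- m)) (Complex A m)) f +
      contour_integral (linepath (Complex A m) (Complex \<sigma> m)) f" by simp
  qed
qed

lemma closed_poles: "closed (poles lam)"
proof -
  have "poles lam = (\<Union>l. (+) (lam $ l) ` \<int>\<^sub>\<le>\<^sub>0)"
  proof (intro equalityI subsetI)
    fix p assume "p \<in> poles lam"
    then obtain l k where "p = lam $ l - of_nat k" by (auto simp: poles_def)
    then show "p \<in> (\<Union>l. (+) (lam $ l) ` \<int>\<^sub>\<le>\<^sub>0)"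
      by (intro UN_I[of l] image_eqI[of _ _ "- of_nat k"]) auto
  next
    fix p assume "p \<in> (\<Union>l. (+) (lam $ l) ` \<int>\<^sub>\<le>\<^sub>0)"
    then obtain l k where "p = lam $ l + - of_nat k" by (auto elim!: nonpos_Ints_cases')
    then show "p \<in> poles lam" by (auto simp: poles_def)
  qed
  then show ?thesis by (auto intro!: closed_UN closed_translation)
qed

lemma finite_poles_right: "finite {p \<in> poles lam. r < Re p}"
proof (rule finite_subset)
  show "{p \<in> poles lam. r < Re p} \<subseteq>
    (\<Union>l. (\<lambda>k. lam $ l - of_nat k) ` {..nat \<lceil>Re (lam $ l) - r\<rceil>})"
  proof
    fix p assume "p \<in> {p \<in> poles lam. r < Re p}"
    then obtain l k where p: "p = lam $ l - of_nat k" "r < Re p" by (auto simp: poles_def)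
    then have "k \<le> nat \<lceil>Re (lam $ l) - r\<rceil>" by (simp add: le_nat_iff) linarith
    then show "p \<in> (\<Union>l. (\<lambda>k. lam $ l - of_nat k) ` {..nat \<lceil>Re (lam $ l) - r\<rceil>})"
      using p by auto
  qed
qed auto

text \<open>The truncated contour has the same integral as three sides of a rectangle, and appending
  the vanishing horizontal ends turns these sides into the path of \<open>box_integral\<close>. The
  limit I does not involve the contour, which is why all admissible contours agree.\<close>

lemma kern_has_upward_integral:
  fixes lam :: "complex ^ 'n::finite"
  assumes adm: "admissible lam \<sigma> T g" and w: "\<bar>Im w\<bar> \<le> pi / 2" and A: "pole_box lam < A"
    and lim: "(\<lambda>m. box_integral (kern lam w) A (real m)) \<longlonglongrightarrow> I"
  shows "has_upward_integral (kern lam w) I \<sigma> T g"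
proof -
  let ?f = "kern lam w"
  define q where "q = real CARD('n) * (\<sigma> - 1/2) - Re (\<Sum>l\<in>UNIV. lam $ l)"
  have up: "upward_contour \<sigma> T g" and left: "poles lam \<subseteq> left_of_contour \<sigma> T g"
    using adm by (auto simp: admissible_def poles_def)
  have T: "0 < T" using up by (simp add: upward_contour_def)
  have q: "q < -1"
  proof -
    have "\<sigma> - 1/2 < 1 / real CARD('n) * (Re (\<Sum>l\<in>UNIV. lam $ l) - 1)"
      using adm by (simp add: admissible_def)
    then have "real CARD('n) * (\<sigma> - 1/2) < Re (\<Sum>l\<in>UNIV. lam $ l) - 1"
      by (simp add: field_simps)
    then show ?thesis by (simp add: q_def)
  qed
  have hol: "?f holomorphic_on - poles lam" by (rule kern_holomorphic) auto
  have off: "p \<notin> contour_image \<sigma> T g" if p: "p \<in> poles lam" for p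
  proof -
    obtain r where "\<And>s. Re s \<le> r \<Longrightarrow> connected_component (- contour_image \<sigma> T g) p s"
      using p left unfolding left_of_contour_def by blast
    from this[of "of_real r"] show ?thesis using connected_component_in by fastforce
  qed
  have "path_image g \<subseteq> - poles lam"
    using off by (auto simp: contour_image_def)
  then have I2: "(?f has_contour_integral contour_integral g ?f) g"
    using up closed_poles[of lam]
    by (intro has_contour_integral_integral contour_integrable_holomorphic_simple[OF hol])
      (auto simp: upward_contour_def)
  obtain C T0 where bd: "\<And>u t. u \<le> \<sigma> \<Longrightarrow> T0 \<le> \<bar>t\<bar> \<Longrightarrow>
      norm (?f (Complex u t)) \<le> C * \<bar>t\<bar> powr q" "T0 \<ge> 4"
    using kern_left_bound[OF w, of \<sigma> lam] unfolding q_def by blast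
  have line: "continuous_on S (\<lambda>t. ?f (Complex \<sigma> t) * \<i>)" if "S \<subseteq> {..- T} \<union> {T..}" for S
  proof -
    have "continuous_on S (Complex \<sigma>)"
      unfolding Complex_eq by (intro continuous_intros)
    moreover have "Complex \<sigma> ` S \<subseteq> - poles lam"
      using off that by (auto simp: contour_image_def)
    ultimately have "continuous_on S (\<lambda>t. ?f (Complex \<sigma> t))"
      by (intro continuous_on_compose2[OF kern_continuous_on[of "- poles lam"]]) auto
    then show ?thesis by (intro continuous_intros)
  qed
  obtain I3 where I3: "((\<lambda>t. ?f (Complex \<sigma> t) * \<i>) has_integral I3) {T..}"
      "((\<lambda>m. integral {T..m} (\<lambda>t. ?f (Complex \<sigma> t) * \<i>)) \<longlongrightarrow> I3) at_top"
  proof (rule has_integral_atLeast_of_powr_bound[of T "\<lambda>t. ?f (Complex \<sigma> t) * \<i>" T0 C q])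
    show "norm (?f (Complex \<sigma> t) * \<i>) \<le> C * t powr q" if "T0 \<le> t" for t
      using bd(1)[of \<sigma> t] bd(2) that by (simp add: norm_mult)
  qed (use line q in auto)
  obtain I1 where I1: "((\<lambda>t. ?f (Complex \<sigma> (- t)) * \<i>) has_integral I1) {T..}"
      "((\<lambda>m. integral {T..m} (\<lambda>t. ?f (Complex \<sigma> (- t)) * \<i>)) \<longlongrightarrow> I1) at_top"
  proof (rule has_integral_atLeast_of_powr_bound[of T "\<lambda>t. ?f (Complex \<sigma> (- t)) * \<i>" T0 C q])
    show "norm (?f (Complex \<sigma> (- t)) * \<i>) \<le> C * t powr q" if "T0 \<le> t" for t
      using bd(1)[of \<sigma> "- t"] bd(2) that by (simp add: norm_mult)
    show "continuous_on {T..} (\<lambda>t. ?f (Complex \<sigma> (- t)) * \<i>)"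
      by (rule continuous_on_compose2[OF line[of "{..- T}"]]) (auto intro!: continuous_intros)
  qed (use q in auto)
  have I1': "((\<lambda>t. ?f (Complex \<sigma> t) * \<i>) has_integral I1) {..- T}"
    by (rule has_integral_atMost_reflect) (rule I1(1))
  have vert: "contour_integral (linepath (Complex \<sigma> a) (Complex \<sigma> c)) ?f =
      integral {a..c} (\<lambda>t. ?f (Complex \<sigma> t) * \<i>)" if "a < c" "{a..c} \<subseteq> {..- T} \<union> {T..}" for a c
    using that line
    by (intro contour_integral_unique has_contour_integral_vertical integrable_integral
        integrable_continuous_interval) auto
  have upper: "eventually (\<lambda>m. contour_integral (linepath (Complex \<sigma> T) (Complex \<sigma> m)) ?f =
      integral {T..m} (\<lambda>t. ?f (Complex \<sigma> t) * \<i>)) at_top"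
    using eventually_gt_at_top[of T] by eventually_elim (rule vert, auto)
  have lower: "eventually (\<lambda>m. contour_integral (linepath (Complex \<sigma> (- m)) (Complex \<sigma> (- T))) ?f =
      integral {T..m} (\<lambda>t. ?f (Complex \<sigma> (- t)) * \<i>)) at_top"
    using eventually_gt_at_top[of T]
  proof eventually_elim
    case (elim m)
    then have "{- m..- T} \<subseteq> {..- T} \<union> {T..}" by auto
    with elim show ?case
      using vert[of "- m" "- T"] Henstock_Kurzweil_Integration.integral_reflect_real[of m T "\<lambda>t. ?f (Complex \<sigma> (- t)) * \<i>"] by simp
  qed
  define I' where "I' = I1 + contour_integral g ?f + I3"
  have "((\<lambda>m. integral {T..m} (\<lambda>t. ?f (Complex \<sigma> (- t)) * \<i>) + contour_integral g ?f +
      integral {T..m} (\<lambda>t. ?f (Complex \<sigma> t) * \<i>)) \<longlongrightarrow> I') at_top"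
    unfolding I'_def by (intro tendsto_add tendsto_const I1(2) I3(2))
  moreover have "eventually (\<lambda>m. integral {T..m} (\<lambda>t. ?f (Complex \<sigma> (- t)) * \<i>) + contour_integral g ?f +
      integral {T..m} (\<lambda>t. ?f (Complex \<sigma> t) * \<i>) =
    contour_integral (linepath (Complex \<sigma> (- m)) (Complex A (- m))) ?f +
      contour_integral (linepath (Complex A (- m)) (Complex A m)) ?f +
      contour_integral (linepath (Complex A m) (Complex \<sigma> m)) ?f) at_top"
  proof -
    have "eventually (\<lambda>m.
      contour_integral (linepath (Complex \<sigma> (- m)) (Complex \<sigma> (- T))) ?f + contour_integral g ?f +
        contour_integral (linepath (Complex \<sigma> T) (Complex \<sigma> m)) ?f =
      contour_integral (linepath (Complex \<sigma> (- m)) (Complex A (- m))) ?f +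
        contour_integral (linepath (Complex A (- m)) (Complex A m)) ?f +
        contour_integral (linepath (Complex A m) (Complex \<sigma> m)) ?f) at_top"
      by (rule truncated_contour_eq_box[OF up left closed_poles finite_poles_right Re_pole_le abs_Im_pole_le A hol])
    then show ?thesis
      using upper lower by eventually_elim simp
  qed
  ultimately have "((\<lambda>m. contour_integral (linepath (Complex \<sigma> (- m)) (Complex A (- m))) ?f +
      contour_integral (linepath (Complex A (- m)) (Complex A m)) ?f +
      contour_integral (linepath (Complex A m) (Complex \<sigma> m)) ?f) \<longlongrightarrow> I') at_top"
    by (rule Lim_transform_eventually)
  then have mid: "(\<lambda>m. contour_integral (linepath (Complex \<sigma> (- real m)) (Complex A (- real m))) ?f +
      contour_integral (linepath (Complex A (- real m)) (Complex A (real m))) ?f +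
      contour_integral (linepath (Complex A (real m)) (Complex \<sigma> (real m))) ?f) \<longlonglongrightarrow> I'"
    by (rule filterlim_compose) (rule filterlim_real_sequentially)
  have hor: "(\<lambda>m. contour_integral (linepath (Complex \<sigma> (real m)) (Complex (- real m) (real m))) ?f) \<longlonglongrightarrow> 0"
    "(\<lambda>m. contour_integral (linepath (Complex \<sigma> (- real m)) (Complex (- real m) (- real m))) ?f) \<longlonglongrightarrow> 0"
    using kern_horizontal_tendsto_0[OF w, of \<sigma> lam 1] kern_horizontal_tendsto_0[OF w, of \<sigma> lam "-1"] q
    by (simp_all add: q_def)
  obtain U where "\<And>a c. a \<in> {s. pole_box lam < Im s} \<Longrightarrow> c \<in> {s. pole_box lam < Im s} \<Longrightarrow>
      (?f has_contour_integral (U c - U a)) (linepath a c)"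
    using holomorphic_linepath_primitive[OF kern_holomorphic[OF half_planes_no_poles(1)]]
      convex_open_half_planes by blast
  then have U: "contour_integral (linepath a c) ?f = U c - U a" if "pole_box lam < Im a" "pole_box lam < Im c" for a c
    using that contour_integral_unique by blast
  obtain L where "\<And>a c. a \<in> {s. Im s < - pole_box lam} \<Longrightarrow> c \<in> {s. Im s < - pole_box lam} \<Longrightarrow>
      (?f has_contour_integral (L c - L a)) (linepath a c)"
    using holomorphic_linepath_primitive[OF kern_holomorphic[OF half_planes_no_poles(2)]]
      convex_open_half_planes by blast
  then have L: "contour_integral (linepath a c) ?f = L c - L a" if "Im a < - pole_box lam" "Im c < - pole_box lam" for a c
    using that contour_integral_unique by blast
  \<comment> \<open>At these heights the horizontal pieces lie in half planes with primitives U and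
    L, so the pieces through Re s = \<sigma> merge into single segments between Re s = -m and Re s =
    A.\<close>
  have "eventually (\<lambda>m::nat. pole_box lam < real m) sequentially" by real_asymp
  then have "eventually (\<lambda>m. contour_integral (linepath (Complex \<sigma> (- real m)) (Complex A (- real m))) ?f +
      contour_integral (linepath (Complex A (- real m)) (Complex A (real m))) ?f +
      contour_integral (linepath (Complex A (real m)) (Complex \<sigma> (real m))) ?f +
      contour_integral (linepath (Complex \<sigma> (real m)) (Complex (- real m) (real m))) ?f -
      contour_integral (linepath (Complex \<sigma> (- real m)) (Complex (- real m) (- real m))) ?f =
      box_integral ?f A (real m)) sequentially"
    by eventually_elim (simp add: box_integral_def U L)
  with tendsto_diff[OF tendsto_add[OF mid hor(1)] hor(2)]
  have "(\<lambda>m. box_integral ?f A (real m)) \<longlonglongrightarrow> I' + 0 - 0"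
    by (rule Lim_transform_eventually)
  then have "I = I1 + contour_integral g ?f + I3"
    using LIMSEQ_unique[OF lim] by (simp add: I'_def)
  then show ?thesis
    unfolding has_upward_integral_def using I1' I2 I3(1) by blast
qed

text \<open>Needed for the uniqueness half of the description in \<open>J_pos\<close>: if no contour
  were admissible, every value would satisfy it. The witness is a rectangle around the right end of
  the pole strip, with \<sigma> chosen far enough to the left.\<close>

lemma admissible_exists:
  fixes lam :: "complex ^ 'n::finite"
  obtains \<sigma> T g where "admissible lam \<sigma> T g"
proof -
  define B where "B = 1 / 2 + 1 / real CARD('n) * (Re (\<Sum>l\<in>UNIV. lam $ l) - 1)"
  define \<sigma> where "\<sigma> = min B 0 - 1"
  define A where "A = pole_box lam + 1"
  define g where "g = linepath (Complex \<sigma> (- A)) (Complex A (- A)) +++ linepath (Complex A (- A)) (Complex A A) +++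
      linepath (Complex A A) (Complex \<sigma> A)"
  have A: "0 < A" by (simp add: A_def add_nonneg_pos)
  have \<sigma>: "\<sigma> < B" "\<sigma> < 0" by (auto simp: \<sigma>_def)
  \<comment> \<open>A connected region on the left of the contour: the half strip inside the
    rectangle holds all poles, and the half plane reaches every point far to the left. They overlap
    because \<sigma> < A.\<close>
  define S where "S = {s. Re s < A \<and> - A < Im s \<and> Im s < A} \<union> {s. Re s < \<sigma>}"
  have "connected S"
    unfolding S_def
  proof (rule connected_Un)
    show "connected {s. Re s < A \<and> - A < Im s \<and> Im s < A}"
      unfolding Collect_conj_eq
      by (intro convex_connected convex_Int convex_halfspace_Re_lt convex_halfspace_Im_gt convex_halfspace_Im_lt)
    show "connected {s. Re s < \<sigma>}"
      by (intro convex_connected convex_halfspace_Re_lt)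
    have "of_real (\<sigma> - 1) \<in> {s. Re s < A \<and> - A < Im s \<and> Im s < A} \<inter> {s. Re s < \<sigma>}"
      using A \<sigma> by simp
    then show "{s. Re s < A \<and> - A < Im s \<and> Im s < A} \<inter> {s. Re s < \<sigma>} \<noteq> {}" by blast
  qed
  moreover have "S \<subseteq> - contour_image \<sigma> A g"
    unfolding S_def contour_image_def g_def using A \<sigma>
    by (auto simp: path_image_join closed_segment_same_Re closed_segment_same_Im
        closed_segment_eq_real_ivl split: if_splits)
  ultimately have comp: "connected_component (- contour_image \<sigma> A g) p s" if "p \<in> S" "s \<in> S" for p s
    using that unfolding connected_component_def by blast
  have "lam $ l - of_nat k \<in> left_of_contour \<sigma> A g" for l k
  proof -
    have "lam $ l - of_nat k \<in> poles lam" by (auto simp: poles_def)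
    then have "lam $ l - of_nat k \<in> S"
      using Re_pole_le abs_Im_pole_le unfolding S_def A_def by fastforce
    moreover have "s \<in> S" if "Re s \<le> \<sigma> - 1" for s using that by (auto simp: S_def)
    ultimately show ?thesis using comp unfolding left_of_contour_def by blast
  qed
  moreover have "upward_contour \<sigma> A g"
    using A unfolding upward_contour_def g_def by (auto intro!: valid_path_join)
  ultimately have "admissible lam \<sigma> A g"
    using \<sigma>(1) unfolding admissible_def B_def by auto
  then show ?thesis by (rule that)
qed

section \<open>Sign patterns and analytic continuation\<close>

definition sign_sum :: "sign ^ 'n::finite \<Rightarrow> complex" where
  "sign_sum vs = (\<Sum>l\<in>UNIV. sign_val (vs $ l))"

definition twisted_sum :: "sign ^ 'n::finite \<Rightarrow> complex ^ 'n \<Rightarrow> complex" where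
  "twisted_sum vs lam = (\<Sum>l\<in>UNIV. sign_val (vs $ l) * lam $ l)"

lemma sum_sign_idx:
  fixes c :: "'n::finite \<Rightarrow> complex"
  shows "sum c UNIV = sum c (sign_idx Plus vs) + sum c (sign_idx Minus vs)"
proof -
  have "UNIV = sign_idx Plus vs \<union> sign_idx Minus vs" "sign_idx Plus vs \<inter> sign_idx Minus vs = {}"
    by (auto simp: sign_idx_def) (metis sign.exhaust)
  then show ?thesis by (metis finite sum.union_disjoint)
qed

lemma sum_sign_val:
  fixes c :: "'n::finite \<Rightarrow> complex"
  shows "(\<Sum>l\<in>UNIV. sign_val (vs $ l) * c l) = sum c (sign_idx Plus vs) - sum c (sign_idx Minus vs)"
proof -
  have "(\<Sum>l\<in>UNIV. sign_val (vs $ l) * c l) =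
      (\<Sum>l\<in>sign_idx Plus vs. sign_val (vs $ l) * c l) + (\<Sum>l\<in>sign_idx Minus vs. sign_val (vs $ l) * c l)"
    by (rule sum_sign_idx)
  also have "\<dots> = sum c (sign_idx Plus vs) + (\<Sum>l\<in>sign_idx Minus vs. - c l)"
    by (intro arg_cong2[of _ _ _ _ "(+)"] sum.cong) (auto simp: sign_idx_def)
  finally show ?thesis by (simp add: sum_negf)
qed

lemma sign_sum_eq: "sign_sum vs = of_nat (card (sign_idx Plus vs)) - of_nat (card (sign_idx Minus vs))"
  using sum_sign_val[of vs "\<lambda>_. 1"] by (simp add: sign_sum_def)

lemma twisted_sum_eq:
  "twisted_sum vs lam = (\<Sum>l\<in>sign_idx Plus vs. lam $ l) - (\<Sum>l\<in>sign_idx Minus vs. lam $ l)"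
  by (simp add: twisted_sum_def sum_sign_val)

lemma card_sign_idx:
  fixes vs :: "sign ^ 'n::finite"
  shows "complex_of_nat CARD('n) = of_nat (card (sign_idx Plus vs)) + of_nat (card (sign_idx Minus vs))"
  using sum_sign_idx[of "\<lambda>_. 1" vs] by simp

definition phase :: "sign ^ 'n::finite \<Rightarrow> complex" where
  "phase vs = of_real pi * \<i> * sign_sum vs / (2 * of_nat CARD('n))"

text \<open>The two sign counts differ by at most n, with equality exactly when all signs agree.
  This keeps the integrals for every sign pattern in the closed strip of convergence.\<close>

lemma abs_Im_phase_le:
  fixes vs :: "sign ^ 'n::finite"
  shows "\<bar>Im (of_real x - phase vs)\<bar> \<le> pi / 2"
proof -
  define k where "k = real (card (sign_idx Plus vs)) - real (card (sign_idx Minus vs))"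
  have "real CARD('n) = real (card (sign_idx Plus vs)) + real (card (sign_idx Minus vs))"
    using card_sign_idx[of vs] by (metis of_nat_add of_nat_eq_iff)
  then have k: "\<bar>k\<bar> \<le> real CARD('n)" by (auto simp: k_def)
  have "phase vs = of_real (pi * k / (2 * real CARD('n))) * \<i>"
    by (simp add: phase_def sign_sum_eq k_def)
  then have "\<bar>Im (of_real x - phase vs)\<bar> = pi / 2 * (\<bar>k\<bar> / real CARD('n))"
    by (simp add: abs_mult)
  also have "\<dots> \<le> pi / 2 * 1"
    using k by (intro mult_left_mono) (auto simp: divide_le_eq_1)
  finally show ?thesis by simp
qed

text \<open>The sign factors multiply to exp(\<pi> i/2 (s \<open>sign_sum vs\<close> -
  \<open>twisted_sum vs lam\<close>)). The part linear in s joins exp(- n s ln x) as a shift of ln x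
  by \<open>phase vs\<close>; the rest is constant in s.\<close>

lemma J_integrand_eq_kern:
  fixes vs :: "sign ^ 'n::finite"
  assumes "x > 0"
  shows "J_integrand x vs lam s =
    exp (- (of_real pi * \<i> / 2 * twisted_sum vs lam)) * kern lam (of_real (ln x) - phase vs) s"
proof -
  let ?n = "of_nat CARD('n) :: complex"
  have "(\<Prod>l\<in>UNIV. e (sign_val (vs $ l) * (s - lam $ l) / 4)) =
      exp (\<Sum>l\<in>UNIV. 2 * of_real pi * \<i> * (sign_val (vs $ l) * (s - lam $ l) / 4))"
    by (simp add: e_def exp_sum)
  also have "(\<Sum>l\<in>UNIV. 2 * of_real pi * \<i> * (sign_val (vs $ l) * (s - lam $ l) / 4)) =
      of_real pi * \<i> / 2 * (s * sign_sum vs - twisted_sum vs lam)"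
    unfolding sign_sum_def twisted_sum_def sum_distrib_left sum_subtractf[symmetric]
    by (intro sum.cong) (auto simp: field_simps)
  finally have "J_integrand x vs lam s = Gamma_prod lam s *
      (exp (of_real pi * \<i> / 2 * (s * sign_sum vs - twisted_sum vs lam)) *
       exp (- (?n * s) * of_real (ln x)))"
    using assms by (simp add: J_integrand_def Gamma_prod_def prod.distrib powr_def Ln_of_real mult.assoc)
  also have "exp (of_real pi * \<i> / 2 * (s * sign_sum vs - twisted_sum vs lam)) *
       exp (- (?n * s) * of_real (ln x)) =
      exp (- (of_real pi * \<i> / 2 * twisted_sum vs lam)) *
       exp (- (?n * s * (of_real (ln x) - phase vs)))"
    unfolding exp_add[symmetric] phase_def by (rule arg_cong[of _ _ exp]) (simp add: field_simps)
  finally show ?thesis by (simp add: kern_def mult_ac)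
qed

lemma has_upward_integral_cmult:
  assumes "has_upward_integral f I \<sigma> T g"
  shows "has_upward_integral (\<lambda>s. c * f s) (c * I) \<sigma> T g"
proof -
  obtain I1 I2 I3 where I: "((\<lambda>t. f (Complex \<sigma> t) * \<i>) has_integral I1) {..- T}"
      "(f has_contour_integral I2) g" "((\<lambda>t. f (Complex \<sigma> t) * \<i>) has_integral I3) {T..}" "I = I1 + I2 + I3"
    using assms unfolding has_upward_integral_def by blast
  have "((\<lambda>t. c * f (Complex \<sigma> t) * \<i>) has_integral c * I1) {..- T}"
    "((\<lambda>t. c * f (Complex \<sigma> t) * \<i>) has_integral c * I3) {T..}"
    using I(1,3) by (simp_all only: mult.assoc has_integral_mult_right)
  moreover have "((\<lambda>s. c * f s) has_contour_integral c * I2) g"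
    by (rule has_contour_integral_lmul[OF I(2)])
  moreover have "c * I = c * I1 + c * I2 + c * I3"
    using I(4) by (simp add: algebra_simps)
  ultimately show ?thesis
    unfolding has_upward_integral_def by blast
qed

lemma has_upward_integral_unique:
  assumes "has_upward_integral f I \<sigma> T g" "has_upward_integral f I' \<sigma> T g"
  shows "I = I'"
  using assms unfolding has_upward_integral_def
  by (metis has_integral_unique has_contour_integral_unique)

lemma J_pos_eq:
  fixes vs :: "sign ^ 'n::finite"
  assumes x: "x > 0" and A: "pole_box lam < A"
    and lim: "\<And>w. (\<lambda>m. box_integral (kern lam w) A (real m)) \<longlonglongrightarrow> F w"
  shows "J_pos x vs lam = 1 / (2 * of_real pi * \<i>) *
    (exp (- (of_real pi * \<i> / 2 * twisted_sum vs lam)) * F (of_real (ln x) - phase vs))"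
proof -
  let ?I = "exp (- (of_real pi * \<i> / 2 * twisted_sum vs lam)) * F (of_real (ln x) - phase vs)"
  have "J_integrand x vs lam = (\<lambda>s. exp (- (of_real pi * \<i> / 2 * twisted_sum vs lam)) *
      kern lam (of_real (ln x) - phase vs) s)"
    using J_integrand_eq_kern[OF x] by blast
  then have int: "has_upward_integral (J_integrand x vs lam) ?I \<sigma> T g" if "admissible lam \<sigma> T g" for \<sigma> T g
    using has_upward_integral_cmult[OF kern_has_upward_integral[OF that abs_Im_phase_le A lim]] by simp
  obtain \<sigma> T g where adm: "admissible lam \<sigma> T g" by (rule admissible_exists)
  show ?thesis
    unfolding J_pos_def
  proof (rule the_equality)
    show "\<exists>I. 1 / (2 * of_real pi * \<i>) * ?I = 1 / (2 * of_real pi * \<i>) * I \<and>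
        (\<forall>\<sigma> T g. admissible lam \<sigma> T g \<longrightarrow> has_upward_integral (J_integrand x vs lam) I \<sigma> T g)"
      using int by blast
  next
    fix v assume "\<exists>I. v = 1 / (2 * of_real pi * \<i>) * I \<and>
        (\<forall>\<sigma> T g. admissible lam \<sigma> T g \<longrightarrow> has_upward_integral (J_integrand x vs lam) I \<sigma> T g)"
    then obtain I where "v = 1 / (2 * of_real pi * \<i>) * I"
        "has_upward_integral (J_integrand x vs lam) I \<sigma> T g"
      using adm by blast
    then show "v = 1 / (2 * of_real pi * \<i>) * ?I"
      using has_upward_integral_unique[OF int[OF adm]] by simp
  qed
qed

text \<open>In the global exponential chart the positive axis becomes the real line, which
  accumulates at 0, so the identity theorem for entire functions applies. The chart point over (x,
  \<omega>) is ln x + i \<omega>.\<close>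

lemma analytic_on_log_surface_unique:
  assumes "analytic_on_log_surface F" "analytic_on_log_surface G"
    and "\<And>x. x > 0 \<Longrightarrow> F (x, 0) = G (x, 0)" and z: "z \<in> log_surface"
  shows "F z = G z"
proof -
  let ?F = "\<lambda>w. F (exp (Re w), Im w)" and ?G = "\<lambda>w. G (exp (Re w), Im w)"
  have "?F w - ?G w = 0" for w
  proof (rule analytic_continuation[where f = "\<lambda>w. ?F w - ?G w" and S = UNIV and U = \<real> and \<xi> = 0])
    show "(\<lambda>w. ?F w - ?G w) holomorphic_on UNIV"
      using assms(1,2) unfolding analytic_on_log_surface_def by (intro holomorphic_intros)
    show "(0::complex) islimpt \<real>"
      unfolding islimpt_approachable
    proof (intro allI impI)
      fix \<epsilon> :: real assume "\<epsilon> > 0"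
      then show "\<exists>y\<in>\<real>. y \<noteq> (0::complex) \<and> dist y 0 < \<epsilon>"
        by (intro bexI[of _ "of_real (\<epsilon> / 2)"]) auto
    qed
    show "?F w - ?G w = 0" if "w \<in> \<real>" for w
      using that assms(3) by (auto simp: complex_is_Real_iff)
  qed auto
  from this[of "Complex (ln (fst z)) (snd z)"] show ?thesis
    using z by (auto simp: log_surface_def)
qed

text \<open>In the chart the right-hand side is an entire function that agrees with
  \<open>J_pos\<close> on the real line. It witnesses that an extension exists, so the choice in
  \<open>J\<close> does return one, and uniqueness identifies the two on the surface.\<close>

lemma J_eq_kern_limit:
  fixes vs :: "sign ^ 'n::finite"
  assumes A: "pole_box lam < A" and hol: "F holomorphic_on UNIV"
    and lim: "\<And>w. (\<lambda>m. box_integral (kern lam w) A (real m)) \<longlonglongrightarrow> F w"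
    and z: "z \<in> log_surface"
  shows "J z vs lam = 1 / (2 * of_real pi * \<i>) *
    (exp (- (of_real pi * \<i> / 2 * twisted_sum vs lam)) * F (Complex (ln (fst z)) (snd z) - phase vs))"
proof -
  define G where "G z = 1 / (2 * of_real pi * \<i>) *
    (exp (- (of_real pi * \<i> / 2 * twisted_sum vs lam)) * F (Complex (ln (fst z)) (snd z) - phase vs))" for z
  have "(\<lambda>w. F (w - phase vs)) holomorphic_on UNIV"
    using holomorphic_on_compose_gen[OF _ hol, of "\<lambda>w. w - phase vs" UNIV]
    by (simp add: o_def holomorphic_intros)
  then have G: "analytic_on_log_surface G"
    unfolding analytic_on_log_surface_def G_def by (simp add: holomorphic_intros)
  have pos: "G (x, 0) = J_pos x vs lam" if "x > 0" for x
    using J_pos_eq[OF that A lim, of vs] by (simp add: G_def complex_of_real_def)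
  define F' where "F' = (SOME F. analytic_on_log_surface F \<and> (\<forall>x>0. F (x, 0) = J_pos x vs lam))"
  have "analytic_on_log_surface F' \<and> (\<forall>x>0. F' (x, 0) = J_pos x vs lam)"
    unfolding F'_def by (rule someI[of _ G]) (simp add: G pos)
  then have F': "analytic_on_log_surface F'" "\<And>x. x > 0 \<Longrightarrow> F' (x, 0) = G (x, 0)"
    by (simp_all add: pos)
  have "F' z = G z"
    by (rule analytic_on_log_surface_unique[OF F'(1) G F'(2) z])
  then show ?thesis by (simp add: J_def G_def F'_def)
qed

theorem lemma11p10:
  fixes vs :: "sign ^ 'n::finite" and lam :: "complex ^ 'n" and z :: "real \<times> real"
  assumes "(\<Sum>l\<in>UNIV. lam $ l) = 0"
    and "z \<in> log_surface"
  shows "J z vs lam =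
           e ((\<Sum>l\<in>sign_idx Minus vs. lam $ l) / 2) *
           H Plus (rotate_by (pi * (real (card (sign_idx Minus vs)) / real CARD('n))) z) lam
         \<and>
         J z vs lam =
           e (- ((\<Sum>l\<in>sign_idx Plus vs. lam $ l) / 2)) *
           H Minus (rotate_by (- (pi * (real (card (sign_idx Plus vs)) / real CARD('n)))) z) lam"
proof -
  let ?n = "complex_of_nat CARD('n)"
  define P where "P = (\<Sum>l\<in>sign_idx Plus vs. lam $ l)"
  define M where "M = (\<Sum>l\<in>sign_idx Minus vs. lam $ l)"
  define np where "np = real (card (sign_idx Plus vs))"
  define nm where "nm = real (card (sign_idx Minus vs))"
  \<comment> \<open>Thus \<open>twisted_sum vs lam\<close> is P - M = - 2 M = 2 P, and the prefactor
    exp(- \<pi> i/2 (P - M)) equals both e(M/2) and e(- P/2).\<close>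
  have PM: "P = - M"
    using assms(1) sum_sign_idx[of "\<lambda>l. lam $ l" vs] by (simp add: P_def M_def add_eq_0_iff2)
  have n: "?n = of_real np + of_real nm"
    using card_sign_idx[of vs] by (simp add: np_def nm_def)
  obtain F where F: "F holomorphic_on UNIV"
      "\<And>w. (\<lambda>m. box_integral (kern lam w) (pole_box lam + 1) (real m)) \<longlonglongrightarrow> F w"
    by (rule kern_entire_limit[of lam "pole_box lam + 1"]) auto
  have J: "J y us lam = 1 / (2 * of_real pi * \<i>) *
      (exp (- (of_real pi * \<i> / 2 * twisted_sum us lam)) * F (Complex (ln (fst y)) (snd y) - phase us))"
    if "y \<in> log_surface" for y us
    by (rule J_eq_kern_limit[OF _ F that]) simp
  have rot: "rotate_by \<alpha> z \<in> log_surface" for \<alpha>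
    using assms(2) by (auto simp: rotate_by_def log_surface_def)
  have const: "twisted_sum (\<chi> l. p) lam = 0" "phase (\<chi> l::'n. p) = of_real pi * \<i> * sign_val p / 2" for p
    using assms(1) by (simp_all add: twisted_sum_def phase_def sign_sum_def flip: sum_distrib_left)
  have ph: "phase vs = of_real pi * \<i> * (of_real np - of_real nm) / (2 * ?n)"
    by (simp add: phase_def sign_sum_eq np_def nm_def)
  have n0: "of_real np + of_real nm \<noteq> (0::complex)"
    using n by (metis of_nat_eq_0_iff zero_less_card_finite less_irrefl)
  \<comment> \<open>With a = \<open>np\<close> and b = \<open>nm\<close> this says that rotating by
    \<pi> b/n, or by - \<pi> a/n, turns the extreme phase \<pi>/2, respectively - \<pi>/2, into the
    phase \<pi> (a - b)/(2 n) of \<open>vs\<close>.\<close>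
  have half: "\<i> * (of_real pi * (b / (a + b))) - of_real pi * \<i> / 2 = - (of_real pi * \<i> * (a - b) / (2 * (a + b)))"
    "of_real pi * \<i> / 2 - \<i> * (of_real pi * (a / (a + b))) = - (of_real pi * \<i> * (a - b) / (2 * (a + b)))"
    if "a + b \<noteq> 0" for a b :: complex
    using that by (simp_all add: divide_simps) (simp_all add: algebra_simps)
  have "Complex (ln (fst z)) (snd z + pi * (nm / real CARD('n))) - phase (\<chi> l::'n. Plus) =
      Complex (ln (fst z)) (snd z) - phase vs"
    unfolding ph const Complex_eq of_real_add of_real_mult of_real_divide of_real_of_nat_eq n
    using half(1)[OF n0] by (simp add: algebra_simps)
  then have "J z vs lam = e (M / 2) * H Plus (rotate_by (pi * (nm / real CARD('n))) z) lam"
    unfolding H_def J[OF rot] J[OF assms(2)] e_def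
    using PM by (simp add: const rotate_by_def twisted_sum_eq[of vs] flip: P_def M_def)
  moreover have "Complex (ln (fst z)) (snd z + - (pi * (np / real CARD('n)))) - phase (\<chi> l::'n. Minus) =
      Complex (ln (fst z)) (snd z) - phase vs"
    unfolding ph const Complex_eq of_real_add of_real_minus of_real_mult of_real_divide of_real_of_nat_eq n
    using half(2)[OF n0] by (simp add: algebra_simps)
  then have "J z vs lam = e (- (P / 2)) * H Minus (rotate_by (- (pi * (np / real CARD('n)))) z) lam"
    unfolding H_def J[OF rot] J[OF assms(2)] e_def
    using PM by (simp add: const rotate_by_def twisted_sum_eq[of vs] flip: P_def M_def)
  ultimately show ?thesis unfolding P_def M_def np_def nm_def by blast
qed

end
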